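(* The Banach--Mazur distance between $L_\infty[0,1]$ and $\ell_\infty$ satisfies $d_{\mathrm{BM}}(L_\infty[0,1],\ell_\infty)\le 9+6\sqrt{3}$.
   Context: Banach spaces are over a fixed scalar field $\mathbb K\in\{\mathbb R,\mathbb C\}$ (the statement is for either choice, the same for both spaces). $L_\infty[0,1]$ is the space of (classes of) essentially bounded functions on $[0,1]$ with Lebesgue measure with the essential supremum norm, and $\ell_\infty$ is the space of bounded scalar sequences with the supremum norm. For isomorphic Banach spaces $X,Y$ the Banach--Mazur distance is $d_{\mathrm{BM}}(X,Y):=\inf\{\|T\|\,\|T^{-1}\| : T\colon X\to Y \text{ is a (linear) isomorphism}\}$; the conclusion includes that the two spaces are isomorphic. *)

theory Defs
  imports "HOL-Analysis.Analysis" "HOL-Probability.Essential_Supremum"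
begin

section \<open>Normed spaces over a scalar field, isomorphisms, Banach--Mazur distance\<close>

text \<open>
  The class \<^class>\<open>real_normed_vector\<close> only provides multiplication by real scalars.  A normed
  space over \<open>'k\<close> (to be instantiated with \<^typ>\<open>real\<close> or \<^typ>\<open>complex\<close>) is a type of that class
  together with a compatible scalar multiplication by \<open>'k\<close>.
\<close>

locale normed_space = vector_space scale
  for scale :: "'k::real_normed_field \<Rightarrow> 'a::real_normed_vector \<Rightarrow> 'a" +
  assumes scale_of_real: "scale (of_real r) x = r *\<^sub>R x"
    and norm_scale: "norm (scale c x) = norm c * norm x"

definition is_isomorphism ::
  "('k::real_normed_field \<Rightarrow> 'a::real_normed_vector \<Rightarrow> 'a) \<Rightarrow>
   ('k \<Rightarrow> 'b::real_normed_vector \<Rightarrow> 'b) \<Rightarrow> ('a \<Rightarrow> 'b) \<Rightarrow> bool" where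
  "is_isomorphism scaleX scaleY T \<longleftrightarrow>
     Vector_Spaces.linear scaleX scaleY T \<and> bij T \<and>
     bounded_linear T \<and> bounded_linear (inv T)"

definition isomorphic ::
  "('k::real_normed_field \<Rightarrow> 'a::real_normed_vector \<Rightarrow> 'a) \<Rightarrow>
   ('k \<Rightarrow> 'b::real_normed_vector \<Rightarrow> 'b) \<Rightarrow> bool" where
  "isomorphic scaleX scaleY \<longleftrightarrow> (\<exists>T. is_isomorphism scaleX scaleY T)"

text \<open>
  The infimum is taken in \<^typ>\<open>real\<close>, so the value is meaningful only for isomorphic spaces.
\<close>

definition banach_mazur_dist ::
  "('k::real_normed_field \<Rightarrow> 'a::real_normed_vector \<Rightarrow> 'a) \<Rightarrow>
   ('k \<Rightarrow> 'b::real_normed_vector \<Rightarrow> 'b) \<Rightarrow> real" where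
  "banach_mazur_dist scaleX scaleY =
     Inf {onorm T * onorm (inv T) | T. is_isomorphism scaleX scaleY T}"


section \<open>The space of bounded sequences\<close>

text \<open>
  The topology of \<^typ>\<open>nat\<close> is discrete, so \<^typ>\<open>nat \<Rightarrow>\<^sub>C 'k\<close> consists of all bounded sequences;
  its norm is the supremum norm.
\<close>

type_synonym 'k ell_infty = "nat \<Rightarrow>\<^sub>C 'k"

lemma bounded_sequence_in_bcontfun:
  "(f :: nat \<Rightarrow> 'k::metric_space) \<in> bcontfun \<longleftrightarrow> bounded (range f)"
  by (simp add: bcontfun_def)

lemma norm_ell_infty: "norm (f :: 'k::real_normed_vector ell_infty) = (SUP n. norm (apply_bcontfun f n))"
  by (simp add: norm_bcontfun_def dist_bcontfun.rep_eq)

definition ell_infty_scale :: "'k::real_normed_field \<Rightarrow> 'k ell_infty \<Rightarrow> 'k ell_infty" where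
  "ell_infty_scale c f = Bcontfun (\<lambda>n. c * apply_bcontfun f n)"

lemma apply_ell_infty_scale [simp]:
  "apply_bcontfun (ell_infty_scale c f) n = c * apply_bcontfun f n"
proof -
  have "bounded (range (\<lambda>n. c * apply_bcontfun f n))"
    by (rule boundedI[where B = "norm c * norm f"])
       (auto simp: norm_mult intro!: mult_left_mono norm_bounded)
  then show ?thesis
    by (simp add: ell_infty_scale_def Bcontfun_inverse bounded_sequence_in_bcontfun)
qed

lemma norm_ell_infty_scale_le: "norm (ell_infty_scale c f) \<le> norm c * norm f"
  by (rule norm_bound) (simp add: norm_mult mult_left_mono norm_bounded)

interpretation ell_infty: normed_space ell_infty_scale
proof
  fix c :: "'k::real_normed_field" and f :: "'k ell_infty"
  show "norm (ell_infty_scale c f) = norm c * norm f"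
  proof (cases "c = 0")
    case True
    have "ell_infty_scale 0 f = 0" by (rule bcontfun_eqI) simp
    with True show ?thesis by simp
  next
    case False
    have "f = ell_infty_scale (inverse c) (ell_infty_scale c f)"
      by (rule bcontfun_eqI) (simp add: False)
    then have "norm f \<le> inverse (norm c) * norm (ell_infty_scale c f)"
      by (metis norm_ell_infty_scale_le norm_inverse)
    then have "norm c * norm f \<le> norm (ell_infty_scale c f)"
      using False by (simp add: field_simps)
    with norm_ell_infty_scale_le show ?thesis by (rule antisym)
  qed
qed (auto intro!: bcontfun_eqI simp: algebra_simps scaleR_conv_of_real)


section \<open>The space of essentially bounded functions on the unit interval\<close>

abbreviation unit_interval_measure :: "real measure" where
  "unit_interval_measure \<equiv> lebesgue_on {0..1}"

definition ess_norm :: "(real \<Rightarrow> 'k::real_normed_vector) \<Rightarrow> ereal" where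
  "ess_norm f = esssup unit_interval_measure (\<lambda>x. ereal (norm (f x)))"

definition ess_bounded :: "(real \<Rightarrow> 'k::real_normed_vector) \<Rightarrow> bool" where
  "ess_bounded f \<longleftrightarrow> f \<in> borel_measurable unit_interval_measure \<and> ess_norm f < \<infinity>"

definition Linf_rel :: "(real \<Rightarrow> 'k::real_normed_vector) \<Rightarrow> (real \<Rightarrow> 'k) \<Rightarrow> bool" where
  "Linf_rel f g \<longleftrightarrow> ess_bounded f \<and> ess_bounded g \<and> (AE x in unit_interval_measure. f x = g x)"

lemma ess_norm_le:
  assumes "f \<in> borel_measurable unit_interval_measure"
    and "AE x in unit_interval_measure. norm (f x) \<le> C"
  shows "ess_norm f \<le> ereal C"
  unfolding ess_norm_def using assms by (intro esssup_I) auto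

lemma emeasure_unit_interval: "emeasure unit_interval_measure (space unit_interval_measure) = 1"
  using emeasure_restrict_space[of "{0..1}" lebesgue "{0..1::real}"] by simp

lemma ess_norm_nonneg:
  assumes "f \<in> borel_measurable unit_interval_measure"
  shows "0 \<le> ess_norm f"
proof -
  have "esssup unit_interval_measure (\<lambda>x. 0::ereal) = 0"
    by (rule esssup_const) (simp only: emeasure_unit_interval zero_neq_one[symmetric], simp)
  moreover have "esssup unit_interval_measure (\<lambda>x. 0::ereal) \<le> ess_norm f"
    unfolding ess_norm_def by (rule esssup_mono) (simp_all add: zero_ereal_def)
  ultimately show ?thesis by simp
qed

lemma ess_bounded_norm:
  assumes "ess_bounded f"
  shows "ess_norm f = ereal (real_of_ereal (ess_norm f))" "0 \<le> real_of_ereal (ess_norm f)"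
    and "AE x in unit_interval_measure. norm (f x) \<le> real_of_ereal (ess_norm f)"
proof -
  have *: "0 \<le> ess_norm f" "ess_norm f < \<infinity>"
    using assms ess_norm_nonneg by (auto simp: ess_bounded_def)
  then show 1: "ess_norm f = ereal (real_of_ereal (ess_norm f))"
    by (cases "ess_norm f") auto
  show "0 \<le> real_of_ereal (ess_norm f)" using * by (simp add: real_of_ereal_pos)
  have "AE x in unit_interval_measure. ereal (norm (f x)) \<le> ess_norm f"
    unfolding ess_norm_def by (rule esssup_AE)
  then show "AE x in unit_interval_measure. norm (f x) \<le> real_of_ereal (ess_norm f)"
    by (subst (asm) 1) simp
qed

lemma ess_norm_le_real:
  assumes "f \<in> borel_measurable unit_interval_measure"
    and "AE x in unit_interval_measure. norm (f x) \<le> C"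
  shows "real_of_ereal (ess_norm f) \<le> C"
  using ess_norm_le[OF assms] ess_norm_nonneg[OF assms(1)] by (cases "ess_norm f") auto

lemma ess_boundedI:
  assumes "f \<in> borel_measurable unit_interval_measure"
    and "AE x in unit_interval_measure. norm (f x) \<le> C"
  shows "ess_bounded f"
  using ess_norm_le[OF assms] assms(1) by (auto simp: ess_bounded_def)

lemma ess_bounded_measurable: "ess_bounded f \<Longrightarrow> f \<in> borel_measurable unit_interval_measure"
  by (simp add: ess_bounded_def)

lemma ess_bounded_zero: "ess_bounded (\<lambda>_. 0)"
  by (rule ess_boundedI[where C = 0]) auto

lemma ess_bounded_add_norm:
  fixes f g :: "real \<Rightarrow> 'k::{real_normed_vector, second_countable_topology}"
  assumes f: "ess_bounded f" and g: "ess_bounded g"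
  shows "ess_bounded (\<lambda>x. f x + g x)"
    and "real_of_ereal (ess_norm (\<lambda>x. f x + g x)) \<le> real_of_ereal (ess_norm f) + real_of_ereal (ess_norm g)"
proof -
  have m: "(\<lambda>x. f x + g x) \<in> borel_measurable unit_interval_measure"
    using f g by (intro borel_measurable_add ess_bounded_measurable)
  have "AE x in unit_interval_measure.
      norm (f x + g x) \<le> real_of_ereal (ess_norm f) + real_of_ereal (ess_norm g)"
    using ess_bounded_norm(3)[OF f] ess_bounded_norm(3)[OF g]
    by eventually_elim (rule norm_triangle_le, simp)
  with m show "ess_bounded (\<lambda>x. f x + g x)"
    "real_of_ereal (ess_norm (\<lambda>x. f x + g x)) \<le> real_of_ereal (ess_norm f) + real_of_ereal (ess_norm g)"
    by (fact ess_boundedI, intro ess_norm_le_real)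
qed

lemma ess_bounded_scale_norm:
  fixes f :: "real \<Rightarrow> 'k::{real_normed_field, second_countable_topology}"
  assumes f: "ess_bounded f"
  shows "ess_bounded (\<lambda>x. c * f x)"
    and "real_of_ereal (ess_norm (\<lambda>x. c * f x)) \<le> norm c * real_of_ereal (ess_norm f)"
proof -
  have m: "(\<lambda>x. c * f x) \<in> borel_measurable unit_interval_measure"
    using f by (intro borel_measurable_times borel_measurable_const ess_bounded_measurable)
  have "AE x in unit_interval_measure. norm (c * f x) \<le> norm c * real_of_ereal (ess_norm f)"
    using ess_bounded_norm(3)[OF f]
    by eventually_elim (simp add: norm_mult mult_left_mono)
  with m show "ess_bounded (\<lambda>x. c * f x)"
    "real_of_ereal (ess_norm (\<lambda>x. c * f x)) \<le> norm c * real_of_ereal (ess_norm f)"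
    by (fact ess_boundedI, intro ess_norm_le_real)
qed

lemma ess_norm_cong:
  assumes "Linf_rel f g"
  shows "ess_norm f = ess_norm g"
  unfolding ess_norm_def
proof (rule esssup_AE_cong)
  show "AE x in unit_interval_measure. ereal (norm (f x)) = ereal (norm (g x))"
    using assms by (auto simp: Linf_rel_def)
qed (use assms in \<open>auto simp: Linf_rel_def ess_bounded_def\<close>)

lemma part_equivp_Linf_rel: "part_equivp (Linf_rel :: (real \<Rightarrow> 'k::real_normed_vector) \<Rightarrow> _)"
proof (rule part_equivpI)
  show "\<exists>f :: real \<Rightarrow> 'k. Linf_rel f f"
    using ess_bounded_zero by (auto simp: Linf_rel_def)
  show "symp (Linf_rel :: (real \<Rightarrow> 'k) \<Rightarrow> _)"
    by (auto simp: symp_def Linf_rel_def elim: eventually_mono)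
  show "transp (Linf_rel :: (real \<Rightarrow> 'k) \<Rightarrow> _)"
    unfolding transp_def Linf_rel_def by (auto elim: eventually_elim2)
qed

quotient_type (overloaded) 'k Linf =
  "real \<Rightarrow> 'k::{real_normed_field, second_countable_topology}" / partial: Linf_rel
  by (rule part_equivp_Linf_rel)

lift_definition Linf_scale ::
  "'k::{real_normed_field, second_countable_topology} \<Rightarrow> 'k Linf \<Rightarrow> 'k Linf"
  is "\<lambda>c f x. c * f x"
  by (auto simp: Linf_rel_def ess_bounded_scale_norm)

instantiation Linf :: ("{real_normed_field, second_countable_topology}") real_normed_vector
begin

lift_definition zero_Linf :: "'a Linf" is "\<lambda>_. 0"
  by (simp add: Linf_rel_def ess_bounded_zero)

lift_definition plus_Linf :: "'a Linf \<Rightarrow> 'a Linf \<Rightarrow> 'a Linf" is "\<lambda>f g x. f x + g x"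
  by (auto simp: Linf_rel_def ess_bounded_add_norm elim: eventually_elim2)

definition uminus_Linf :: "'a Linf \<Rightarrow> 'a Linf" where
  "uminus_Linf f = Linf_scale (- 1) f"

definition minus_Linf :: "'a Linf \<Rightarrow> 'a Linf \<Rightarrow> 'a Linf" where
  "minus_Linf f g = f + - g"

definition scaleR_Linf :: "real \<Rightarrow> 'a Linf \<Rightarrow> 'a Linf" where
  "scaleR_Linf r f = Linf_scale (of_real r) f"

lift_definition norm_Linf :: "'a Linf \<Rightarrow> real" is "\<lambda>f. real_of_ereal (ess_norm f)"
  by (simp add: ess_norm_cong)

definition dist_Linf :: "'a Linf \<Rightarrow> 'a Linf \<Rightarrow> real" where
  "dist_Linf f g = norm (f - g)"

definition sgn_Linf :: "'a Linf \<Rightarrow> 'a Linf" where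
  "sgn_Linf f = inverse (norm f) *\<^sub>R f"

definition uniformity_Linf :: "('a Linf \<times> 'a Linf) filter" where
  "uniformity_Linf = (INF e\<in>{0 <..}. principal {(x, y). dist x y < e})"

definition open_Linf :: "'a Linf set \<Rightarrow> bool" where
  "open_Linf S = (\<forall>x\<in>S. \<forall>\<^sub>F (x', y) in uniformity. x' = x \<longrightarrow> y \<in> S)"

lemma Linf_scale_simps:
  fixes f g :: "'a Linf"
  shows "Linf_scale c (f + g) = Linf_scale c f + Linf_scale c g"
    and "Linf_scale (c + d) f = Linf_scale c f + Linf_scale d f"
    and "Linf_scale c (Linf_scale d f) = Linf_scale (c * d) f"
    and "Linf_scale 1 f = f"
    and "Linf_scale 0 f = 0"
  by (transfer; simp add: Linf_rel_def ess_bounded_scale_norm ess_bounded_add_norm ess_bounded_zero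
      algebra_simps)+

lemma norm_Linf_scale_le: "norm (Linf_scale c (f :: 'a Linf)) \<le> norm c * norm f"
  by transfer (simp add: Linf_rel_def ess_bounded_scale_norm)

lemma norm_Linf_scale: "norm (Linf_scale c (f :: 'a Linf)) = norm c * norm f"
proof (cases "c = 0")
  case True
  have "norm (0 :: 'a Linf) \<le> 0"
    by transfer (rule ess_norm_le_real, simp_all)
  moreover have "0 \<le> norm (0 :: 'a Linf)"
    by transfer (simp add: ess_bounded_norm(2) ess_bounded_zero)
  ultimately show ?thesis using True by (simp add: Linf_scale_simps)
next
  case False
  have "norm f \<le> norm (inverse c) * norm (Linf_scale c f)"
    using norm_Linf_scale_le[of "inverse c" "Linf_scale c f"] False
    by (simp add: Linf_scale_simps)
  then have "norm c * norm f \<le> norm (Linf_scale c f)"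
    using False by (simp add: norm_divide field_simps)
  with norm_Linf_scale_le show ?thesis by (rule antisym)
qed

instance
proof
  fix f g h :: "'a Linf" and r s :: real
  show "f + g + h = f + (g + h)"
    by transfer (simp add: Linf_rel_def ess_bounded_add_norm add.assoc)
  show "f + g = g + f"
    by transfer (simp add: Linf_rel_def ess_bounded_add_norm add.commute)
  show "0 + f = f"
    by transfer (simp add: Linf_rel_def)
  show "- f + f = 0"
    using Linf_scale_simps(2)[of "- 1" 1 f]
    by (simp only: uminus_Linf_def Linf_scale_simps(4,5) add.left_inverse)
  show "f - g = f + - g" by (simp add: minus_Linf_def)
  show "r *\<^sub>R (f + g) = r *\<^sub>R f + r *\<^sub>R g" "(r + s) *\<^sub>R f = r *\<^sub>R f + s *\<^sub>R f"
    "r *\<^sub>R s *\<^sub>R f = (r * s) *\<^sub>R f" "1 *\<^sub>R f = f"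
    by (simp_all add: scaleR_Linf_def Linf_scale_simps)
  show "dist f g = norm (f - g)" by (simp add: dist_Linf_def)
  show "sgn f = inverse (norm f) *\<^sub>R f" by (simp add: sgn_Linf_def)
  show "(uniformity :: ('a Linf \<times> 'a Linf) filter) =
      (INF e\<in>{0 <..}. principal {(x, y). dist x y < e})"
    by (simp add: uniformity_Linf_def)
  show "open S = (\<forall>x\<in>S. \<forall>\<^sub>F (x', y) in uniformity. x' = x \<longrightarrow> y \<in> S)" for S :: "'a Linf set"
    by (simp add: open_Linf_def)
  show "norm (f + g) \<le> norm f + norm g"
    by transfer (simp add: Linf_rel_def ess_bounded_add_norm)
  show "norm (r *\<^sub>R f) = \<bar>r\<bar> * norm f"
    by (simp add: scaleR_Linf_def norm_Linf_scale)
  show "norm f = 0 \<longleftrightarrow> f = 0"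
  proof
    assume "f = 0"
    then show "norm f = 0" using norm_Linf_scale[of 0 f] by (simp add: Linf_scale_simps)
  next
    assume "norm f = 0"
    then show "f = 0"
    proof transfer
      fix f :: "real \<Rightarrow> 'a"
      assume "Linf_rel f f" and 0: "real_of_ereal (ess_norm f) = 0"
      then have "ess_bounded f" by (simp add: Linf_rel_def)
      with ess_bounded_norm(3)[of f] 0 show "Linf_rel f (\<lambda>_. 0)"
        by (simp add: Linf_rel_def ess_bounded_zero)
    qed
  qed
qed

end

interpretation Linf: normed_space Linf_scale
  by standard (simp_all add: Linf_scale_simps scaleR_Linf_def norm_Linf_scale)

end

theory Submission
  imports Defs
begin

text \<open>
  Write \<open>X\<close> for \<open>L\<^sub>\<infinity>[0,1]\<close> and \<open>Y\<close> for the space of bounded sequences.  The proof is a weighted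
  form of Pelczynski's decomposition argument.  It rests on two facts.

  First, each space is isometric to the space of bounded sequences in itself: a function is
  determined by its rescaled restrictions to the intervals \<open>[2\<^sup>-\<^sup>n\<^sup>-\<^sup>1, 2\<^sup>-\<^sup>n]\<close>, and a sequence
  indexed by pairs is a sequence of sequences.  So an element \<open>x\<close> of either space has
  coordinates \<open>x\<^sub>0, x\<^sub>1, \<dots>\<close> in the same space, with no constraint but boundedness
  (locale \<open>self_power\<close>).

  Second, each space sits isometrically in the other as the range of a contractive projection:
  there are linear contractions \<open>j : Y \<rightarrow> X\<close>, \<open>p : X \<rightarrow> Y\<close>, \<open>i : X \<rightarrow> Y\<close>, \<open>q : Y \<rightarrow> X\<close> with \<open>p j = 1\<close> and
  \<open>q i = 1\<close> (locale \<open>mutually_complemented\<close>).  Here \<open>j\<close> makes a sequence constant on the above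
  intervals and \<open>p\<close> takes the means.  The map \<open>i\<close> records the averages of a function over all
  intervals \<open>[k/(n+1), (k+1)/(n+1)]\<close>.  For \<open>q\<close>, a bounded sequence indexed by \<open>(n, k)\<close> is read as a
  sequence of step functions, and \<open>q\<close> returns its weak-star limit along a filter along which all
  bounded scalar sequences converge (\<open>ex_convergent_filter\<close>).  The limit is found through
  primitives: those of the step functions converge to a Lipschitz function, and a Lipschitz
  function has a bounded density (\<open>lipschitz_has_density\<close>).

  Given all this, let \<open>v = p x\<^sub>0\<close> with coordinates \<open>v\<^sub>n\<close> in \<open>Y\<close>, and let \<open>u\<close> be the element of \<open>X\<close> with
  coordinates \<open>u\<^sub>n = (x\<^sub>n - j p x\<^sub>n) + b j p x\<^sub>n\<^sub>+\<^sub>1\<close>.  Shifting the \<open>Y\<close>-components by one place splits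
  \<open>v\<close> off from \<open>x\<close> and leaves \<open>u\<close>.  The same shift in \<open>Y\<close> makes room for \<open>u\<close> inside \<open>v\<close>: the image
  of \<open>x\<close> has the coordinates \<open>r (v\<^sub>0 - i q v\<^sub>0) + i u\<close> and
  \<open>r (v\<^sub>n\<^sub>+\<^sub>1 - i q v\<^sub>n\<^sub>+\<^sub>1) + t i q v\<^sub>n\<close>.  As the projections \<open>j p\<close> and \<open>i q\<close> have norm at most 1, their
  complements have norm at most 2.  With \<open>t = 2 + b\<close> this bounds the norm of the isomorphism by
  \<open>2 r + 2 + b\<close> and that of its inverse by the larger of \<open>2 + 2/r + 1/t\<close> and \<open>2 + 1/b\<close>.  The choice
  \<open>r = \<surd>3/2\<close>, \<open>b = (\<surd>3 - 1)/2\<close> makes the latter two equal to \<open>3 + \<surd>3\<close>, and the product of the bounds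
  is \<open>9 + 6\<surd>3\<close> (\<open>isomorphic_dist_le\<close>).  The scalars enter only through the compactness of
  closed bounded sets and through componentwise integration, so the real and the complex case are
  one argument.
\<close>

section \<open>Weighted decomposition of mutually complemented spaces\<close>

text \<open>
  The maps \<open>coord n\<close> exhibit the space as isometric to the space of all bounded sequences in it.
  Stating this through coordinates avoids a separate type of vector-valued sequences.
\<close>

locale self_power = normed_space scale
  for scale :: "'k::real_normed_field \<Rightarrow> 'a::real_normed_vector \<Rightarrow> 'a" +
  fixes coord :: "nat \<Rightarrow> 'a \<Rightarrow> 'a"
  assumes coord_add: "coord n (x + y) = coord n x + coord n y"
    and coord_scale: "coord n (scale c x) = scale c (coord n x)"
    and norm_coord_le: "norm (coord n x) \<le> norm x"
    and norm_le_coord: "(\<And>n. norm (coord n x) \<le> C) \<Longrightarrow> norm x \<le> C"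
    and ex_glue: "(\<And>n. norm (s n) \<le> C) \<Longrightarrow> \<exists>x. \<forall>n. coord n x = s n"
begin

definition glue :: "(nat \<Rightarrow> 'a) \<Rightarrow> 'a" where
  "glue s = (SOME x. \<forall>n. coord n x = s n)"

lemma coord_glue: "(\<And>n. norm (s n) \<le> C) \<Longrightarrow> coord n (glue s) = s n"
  using someI_ex[OF ex_glue, of s C] by (simp add: glue_def)

lemma coord_scaleR: "coord n (r *\<^sub>R x) = r *\<^sub>R coord n x"
  by (metis coord_scale scale_of_real)

lemma coord_diff: "coord n (x - y) = coord n x - coord n y"
  using coord_add[of n x "- y"] coord_scaleR[of n "- 1" y] by simp

lemma coord_inject: "(\<And>n. coord n x = coord n y) \<Longrightarrow> x = y"
  using norm_le_coord[of "x - y" 0] by (simp add: coord_diff)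

lemma norm_glue_le: "(\<And>n. norm (s n) \<le> C) \<Longrightarrow> norm (glue s) \<le> C"
  by (rule norm_le_coord) (metis coord_glue)

end

lemma (in normed_space) scaleR_scale_commute: "r *\<^sub>R scale c x = scale c (r *\<^sub>R x)"
  by (metis scale_left_commute scale_of_real)

lemma linear_add': "Vector_Spaces.linear s1 s2 f \<Longrightarrow> f (x + y) = f x + f y"
  by (simp add: Vector_Spaces.linear_iff)

lemma linear_scale': "Vector_Spaces.linear s1 s2 f \<Longrightarrow> f (s1 c x) = s2 c (f x)"
  by (simp add: Vector_Spaces.linear_iff)

lemma linear_scaleR:
  assumes "Vector_Spaces.linear s1 s2 f" "normed_space s1" "normed_space s2"
  shows "f (r *\<^sub>R x) = r *\<^sub>R f x"
  using linear_scale'[OF assms(1), of "of_real r" x]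
  by (simp add: normed_space.scale_of_real[OF assms(2)] normed_space.scale_of_real[OF assms(3)])

lemma linear_diff':
  assumes "Vector_Spaces.linear s1 s2 f"
  shows "f (x - y) = f x - f y"
  using linear_add'[OF assms, of "x - y" y, symmetric] by (simp only: diff_add_cancel eq_diff_eq)

lemma banach_mazur_dist_le_of_inverse:
  assumes "Vector_Spaces.linear sX sY T" "normed_space sX" "normed_space sY"
    and "\<And>x. S (T x) = x" "\<And>y. T (S y) = y"
    and "\<And>x. norm (T x) \<le> a * norm x" "\<And>y. norm (S y) \<le> b * norm y"
    and "0 \<le> a" "0 \<le> b"
  shows "isomorphic sX sY \<and> banach_mazur_dist sX sY \<le> a * b"
proof -
  have bij: "bij T" by (rule o_bij[of S]) (simp_all add: fun_eq_iff assms(4,5))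
  have inv: "inv T = S" by (rule inv_unique_comp) (simp_all add: fun_eq_iff assms(4,5))
  have add: "T (x + y) = T x + T y" for x y
    using assms(1) by (rule linear_add')
  have scaleR: "T (r *\<^sub>R x) = r *\<^sub>R T x" for r x
    using assms(1-3) by (rule linear_scaleR)
  have bl: "bounded_linear T"
  proof (rule bounded_linear_intro)
    show "norm (T x) \<le> norm x * a" for x
      using assms(6)[of x] by (simp only: mult.commute)
  qed (fact add scaleR)+
  have bl': "bounded_linear S"
  proof (rule bounded_linear_intro)
    show "S (x + y) = S x + S y" for x y
      using assms(4)[of "S x + S y"] by (simp only: add assms(5))
    show "S (r *\<^sub>R x) = r *\<^sub>R S x" for r x
      using assms(4)[of "r *\<^sub>R S x"] by (simp only: scaleR assms(5))
    show "norm (S y) \<le> norm y * b" for y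
      using assms(7)[of y] by (simp only: mult.commute)
  qed
  have iso: "is_isomorphism sX sY T"
    unfolding is_isomorphism_def inv using assms(1) bij bl bl' by blast
  have "banach_mazur_dist sX sY \<le> onorm T * onorm (inv T)"
    unfolding banach_mazur_dist_def
  proof (rule cInf_lower)
    show "bdd_below {onorm T * onorm (inv T) |T. is_isomorphism sX sY T}"
      by (rule bdd_belowI[of _ 0]) (auto simp: is_isomorphism_def onorm_pos_le)
    show "onorm T * onorm (inv T) \<in> {onorm T * onorm (inv T) |T. is_isomorphism sX sY T}"
      using iso by blast
  qed
  also have "\<dots> \<le> a * b"
    unfolding inv
  proof (rule mult_mono')
    show "onorm T \<le> a" using assms(8,6) by (rule onorm_bound)
    show "onorm S \<le> b" using assms(9,7) by (rule onorm_bound)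
  qed (simp_all add: onorm_pos_le bl bl')
  finally show ?thesis using iso isomorphic_def by blast
qed

text \<open>
  The assumptions make \<open>j \<circ> p\<close> and \<open>i \<circ> q\<close> contractive projections onto isometric copies of each
  space in the other.
\<close>

locale mutually_complemented =
  X: self_power scaleX coordX + Y: self_power scaleY coordY
  for scaleX :: "'k::real_normed_field \<Rightarrow> 'x::real_normed_vector \<Rightarrow> 'x"
    and coordX :: "nat \<Rightarrow> 'x \<Rightarrow> 'x"
    and scaleY :: "'k \<Rightarrow> 'y::real_normed_vector \<Rightarrow> 'y"
    and coordY :: "nat \<Rightarrow> 'y \<Rightarrow> 'y" +
  fixes j :: "'y \<Rightarrow> 'x" and p :: "'x \<Rightarrow> 'y" and i :: "'x \<Rightarrow> 'y" and q :: "'y \<Rightarrow> 'x"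
  assumes linear_j: "Vector_Spaces.linear scaleY scaleX j"
    and linear_p: "Vector_Spaces.linear scaleX scaleY p"
    and linear_i: "Vector_Spaces.linear scaleX scaleY i"
    and linear_q: "Vector_Spaces.linear scaleY scaleX q"
    and norm_j: "norm (j y) \<le> norm y"
    and norm_p: "norm (p x) \<le> norm x"
    and norm_i: "norm (i x) \<le> norm x"
    and norm_q: "norm (q y) \<le> norm y"
    and p_j: "p (j y) = y"
    and q_i: "q (i x) = x"
begin

lemmas map_add = linear_j[THEN linear_add'] linear_p[THEN linear_add']
  linear_i[THEN linear_add'] linear_q[THEN linear_add'] X.coord_add Y.coord_add

lemmas map_diff = linear_j[THEN linear_diff'] linear_p[THEN linear_diff']
  linear_i[THEN linear_diff'] linear_q[THEN linear_diff'] X.coord_diff Y.coord_diff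

lemmas map_scale = linear_j[THEN linear_scale'] linear_p[THEN linear_scale']
  linear_i[THEN linear_scale'] linear_q[THEN linear_scale'] X.coord_scale Y.coord_scale

lemmas map_scaleR = linear_j[THEN linear_scaleR, OF Y.normed_space_axioms X.normed_space_axioms]
  linear_p[THEN linear_scaleR, OF X.normed_space_axioms Y.normed_space_axioms]
  linear_i[THEN linear_scaleR, OF X.normed_space_axioms Y.normed_space_axioms]
  linear_q[THEN linear_scaleR, OF Y.normed_space_axioms X.normed_space_axioms]
  X.coord_scaleR Y.coord_scaleR

lemma norm_jp: "norm (j (p x)) \<le> norm x" and norm_iq: "norm (i (q y)) \<le> norm y"
  by (rule order_trans[OF norm_j norm_p], rule order_trans[OF norm_i norm_q])

text \<open>
  Every coordinate that the isomorphism or its inverse produces is the complementary part of an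
  element plus one more term, so all norm bounds of the construction reduce to this estimate.
\<close>

lemma norm_combineX:
  assumes "norm x \<le> C" "norm z \<le> D"
  shows "norm (x - j (p x) + z) \<le> 2 * C + D"
  using norm_triangle_ineq[of "x - j (p x)" z] norm_triangle_ineq4[of x "j (p x)"]
    norm_jp[of x] assms by linarith

lemma norm_combineY:
  assumes "norm y \<le> C" "norm z \<le> D"
  shows "norm (y - i (q y) + z) \<le> 2 * C + D"
  using norm_triangle_ineq[of "y - i (q y)" z] norm_triangle_ineq4[of y "i (q y)"]
    norm_iq[of y] assms by linarith

context
  fixes r b t :: real
  assumes pos: "r > 0" "b > 0" and t: "t = 2 + b"
begin

lemma t_pos: "t > 0"
  using pos t by simp

text \<open>
  The decomposition \<open>X = (Y \<oplus> A)\<^sup>\<nat>\<close> with \<open>A\<close> the kernel of \<open>p\<close>: the \<open>A\<close>-components stay, the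
  \<open>Y\<close>-components move down one place, and the zeroth one is left for \<open>regroupY\<close>.
\<close>

definition regroupX :: "'x \<Rightarrow> nat \<Rightarrow> 'x" where
  "regroupX x n = coordX n x - j (p (coordX n x)) + b *\<^sub>R j (p (coordX (Suc n) x))"

text \<open>
  The decomposition \<open>Y = (X \<oplus> B)\<^sup>\<nat>\<close> with \<open>B\<close> the kernel of \<open>q\<close>: the \<open>X\<close>-components of \<open>v\<close> move up one
  place, and the regrouped rest of \<open>x\<close> fills the vacant zeroth one.  That rest can have norm
  \<open>(2 + b) \<parallel>x\<parallel>\<close>, so the weight \<open>t = 2 + b\<close> on the other \<open>X\<close>-components costs nothing.
\<close>

definition regroupY :: "'x \<Rightarrow> nat \<Rightarrow> 'y" where
  "regroupY x n = (let v = p (coordX 0 x) in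
     r *\<^sub>R (coordY n v - i (q (coordY n v))) +
       (case n of 0 \<Rightarrow> i (X.glue (regroupX x)) | Suc m \<Rightarrow> t *\<^sub>R i (q (coordY m v))))"

text \<open>
  In \<open>recoverY\<close> and \<open>recoverX\<close> the two shifts are undone, \<open>recoverY\<close> producing the coordinates of
  \<open>v = p x\<^sub>0\<close> and \<open>recoverX\<close> those of \<open>x\<close>.
\<close>

definition recoverY :: "'y \<Rightarrow> nat \<Rightarrow> 'y" where
  "recoverY y n = (1 / r) *\<^sub>R (coordY n y - i (q (coordY n y))) + (1 / t) *\<^sub>R i (q (coordY (Suc n) y))"

definition recoverX :: "'y \<Rightarrow> nat \<Rightarrow> 'x" where
  "recoverX y n = (let u = q (coordY 0 y) in
     coordX n u - j (p (coordX n u)) +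
       (case n of 0 \<Rightarrow> j (Y.glue (recoverY y)) | Suc m \<Rightarrow> (1 / b) *\<^sub>R j (p (coordX m u))))"

lemma norm_regroupX: "norm (regroupX x n) \<le> (2 + b) * norm x"
proof -
  have "norm (b *\<^sub>R j (p (coordX (Suc n) x))) \<le> b * norm x"
    using pos order_trans[OF norm_jp X.norm_coord_le, of "Suc n" x] by simp
  from norm_combineX[OF X.norm_coord_le[of n x] this] show ?thesis
    by (simp add: regroupX_def algebra_simps)
qed

lemma norm_regroupY: "norm (regroupY x n) \<le> (2 * r + 2 + b) * norm x"
proof -
  define v where "v = p (coordX 0 x)"
  have v: "norm (coordY m v) \<le> norm x" for m
    unfolding v_def by (meson X.norm_coord_le Y.norm_coord_le norm_p order_trans)
  define z where "z = (case n of 0 \<Rightarrow> i (X.glue (regroupX x)) | Suc m \<Rightarrow> t *\<^sub>R i (q (coordY m v)))"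
  have "norm z \<le> (2 + b) * norm x"
  proof (cases n)
    case 0
    then show ?thesis
      using order_trans[OF norm_i X.norm_glue_le[OF norm_regroupX], of x] by (simp add: z_def)
  next
    case (Suc m)
    have "norm (i (q (coordY m v))) \<le> norm x" using norm_iq v order_trans by blast
    then show ?thesis using pos by (simp add: z_def Suc t mult_left_mono)
  qed
  moreover have "norm (r *\<^sub>R coordY n v) \<le> r * norm x" using pos v by simp
  ultimately have "norm (r *\<^sub>R coordY n v - i (q (r *\<^sub>R coordY n v)) + z) \<le> 2 * (r * norm x) + (2 + b) * norm x"
    by (intro norm_combineY)
  then show ?thesis
    unfolding regroupY_def Let_def v_def[symmetric] z_def[symmetric]
    by (simp add: map_scaleR algebra_simps)
qed

lemma norm_recoverY: "norm (recoverY y n) \<le> (2 / r + 1 / t) * norm y"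
proof -
  have 1: "norm ((1/r) *\<^sub>R coordY n y) \<le> (1/r) * norm y"
    using pos Y.norm_coord_le by (simp add: divide_right_mono)
  have 2: "norm ((1/t) *\<^sub>R i (q (coordY (Suc n) y))) \<le> (1/t) * norm y"
    using pos t_pos order_trans[OF norm_iq Y.norm_coord_le, of "Suc n" y] by (simp add: divide_right_mono)
  from norm_combineY[OF 1 2] show ?thesis
    by (simp add: recoverY_def map_scaleR algebra_simps)
qed

lemma norm_recoverX:
  assumes "2 + 1 / b \<le> B" "2 + 2 / r + 1 / t \<le> B"
  shows "norm (recoverX y n) \<le> B * norm y"
proof -
  define u where "u = q (coordY 0 y)"
  have u: "norm (coordX m u) \<le> norm y" for m
    unfolding u_def by (meson X.norm_coord_le Y.norm_coord_le norm_q order_trans)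
  define z where "z = (case n of 0 \<Rightarrow> j (Y.glue (recoverY y)) | Suc m \<Rightarrow> (1/b) *\<^sub>R j (p (coordX m u)))"
  have "norm z \<le> (B - 2) * norm y"
  proof (cases n)
    case 0
    have "norm z \<le> (2 / r + 1 / t) * norm y"
      using order_trans[OF norm_j Y.norm_glue_le[OF norm_recoverY]] by (simp add: z_def 0)
    also have "\<dots> \<le> (B - 2) * norm y" using assms(2) by (intro mult_right_mono) auto
    finally show ?thesis .
  next
    case (Suc m)
    have "norm z \<le> (1 / b) * norm y"
      using pos order_trans[OF norm_jp u] by (simp add: z_def Suc divide_right_mono)
    also have "\<dots> \<le> (B - 2) * norm y" using assms(1) by (intro mult_right_mono) auto
    finally show ?thesis .
  qed
  from norm_combineX[OF u[of n] this] show ?thesis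
    unfolding recoverX_def Let_def u_def[symmetric] z_def[symmetric]
    by (simp add: algebra_simps)
qed

lemmas coord_glue_regroupX = X.coord_glue[OF norm_regroupX]
lemmas coord_glue_regroupY = Y.coord_glue[OF norm_regroupY]
lemmas coord_glue_recoverY = Y.coord_glue[OF norm_recoverY]

lemma coord_glue_recoverX: "coordX n (X.glue (recoverX y)) = recoverX y n"
  by (rule X.coord_glue, rule norm_recoverX[where B = "max (2 + 1 / b) (2 + 2 / r + 1 / t)"]) simp_all

lemma glue_regroupX_add: "X.glue (regroupX (x + y)) = X.glue (regroupX x) + X.glue (regroupX y)"
  by (rule X.coord_inject) (simp add: coord_glue_regroupX X.coord_add, simp add: regroupX_def map_add algebra_simps)

lemma glue_regroupX_scale: "X.glue (regroupX (scaleX c x)) = scaleX c (X.glue (regroupX x))"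
  by (rule X.coord_inject)
    (simp add: coord_glue_regroupX X.coord_scale, simp add: regroupX_def map_scale X.scaleR_scale_commute
      X.scale_right_distrib X.scale_right_diff_distrib)

lemma linear_glue_regroupY: "Vector_Spaces.linear scaleX scaleY (\<lambda>x. Y.glue (regroupY x))"
proof (unfold Vector_Spaces.linear_iff, intro conjI allI)
  fix x y c
  show "Y.glue (regroupY (x + y)) = Y.glue (regroupY x) + Y.glue (regroupY y)"
    by (rule Y.coord_inject) (simp add: coord_glue_regroupY Y.coord_add,
        simp add: regroupY_def Let_def glue_regroupX_add map_add algebra_simps split: nat.split)
  show "Y.glue (regroupY (scaleX c x)) = scaleY c (Y.glue (regroupY x))"
    by (rule Y.coord_inject) (simp add: coord_glue_regroupY Y.coord_scale,
      simp add: regroupY_def Let_def glue_regroupX_scale map_scale Y.scaleR_scale_commute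
      Y.scale_right_distrib Y.scale_right_diff_distrib scaleR_diff_right split: nat.split)
qed (simp_all add: X.vector_space_axioms Y.vector_space_axioms)

lemma recover_regroup: "X.glue (recoverX (Y.glue (regroupY x))) = x"
proof -
  define v where "v = p (coordX 0 x)"
  define y where "y = Y.glue (regroupY x)"
  have q0: "q (coordY 0 y) = X.glue (regroupX x)"
    by (simp add: y_def coord_glue_regroupY, simp add: regroupY_def Let_def map_scaleR map_diff map_add q_i)
  have qS: "q (coordY (Suc n) y) = t *\<^sub>R q (coordY n v)" for n
    by (simp add: y_def coord_glue_regroupY, simp add: regroupY_def Let_def map_scaleR map_diff map_add q_i v_def)
  have w: "coordY n y - i (q (coordY n y)) = r *\<^sub>R (coordY n v - i (q (coordY n v)))" for n
    by (cases n) (simp_all add: q0 qS, simp_all add: y_def coord_glue_regroupY,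
      simp_all add: regroupY_def Let_def map_scaleR map_diff map_add q_i v_def)
  have "recoverY y n = coordY n v" for n
  proof -
    have "recoverY y n = (1 / r) *\<^sub>R (r *\<^sub>R (coordY n v - i (q (coordY n v)))) +
        (1 / t) *\<^sub>R (t *\<^sub>R i (q (coordY n v)))"
      by (simp only: recoverY_def w qS map_scaleR)
    also have "\<dots> = coordY n v" using pos t_pos by simp
    finally show ?thesis .
  qed
  then have v: "Y.glue (recoverY y) = v"
    by - (rule Y.coord_inject, simp add: coord_glue_recoverY)
  have pu: "p (coordX n (X.glue (regroupX x))) = b *\<^sub>R p (coordX (Suc n) x)" for n
    by (simp add: coord_glue_regroupX, simp add: regroupX_def map_scaleR map_diff map_add p_j)
  have "recoverX y n = coordX n x" for n
    using pos
    by (cases n) (simp_all add: recoverX_def Let_def q0 pu v, simp_all add: coord_glue_regroupX,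
      simp_all add: regroupX_def v_def map_scaleR)
  then show ?thesis
    unfolding y_def[symmetric] by - (rule X.coord_inject, simp add: coord_glue_recoverX)
qed

lemma regroup_recover: "Y.glue (regroupY (X.glue (recoverX y))) = y"
proof -
  define u where "u = q (coordY 0 y)"
  define x where "x = X.glue (recoverX y)"
  have p0: "p (coordX 0 x) = Y.glue (recoverY y)"
    by (simp add: x_def coord_glue_recoverX, simp add: recoverX_def Let_def map_scaleR map_diff map_add p_j)
  have pS: "p (coordX (Suc n) x) = (1 / b) *\<^sub>R p (coordX n u)" for n
    by (simp add: x_def coord_glue_recoverX, simp add: recoverX_def Let_def map_scaleR map_diff map_add p_j u_def)
  have w: "coordX n x - j (p (coordX n x)) = coordX n u - j (p (coordX n u))" for n
    by (cases n) (simp_all add: p0 pS, simp_all add: x_def coord_glue_recoverX,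
      simp_all add: recoverX_def Let_def map_scaleR map_diff map_add p_j u_def)
  have "regroupX x n = coordX n u" for n
  proof -
    have "regroupX x n = coordX n u - j (p (coordX n u)) + b *\<^sub>R ((1 / b) *\<^sub>R j (p (coordX n u)))"
      by (simp only: regroupX_def w pS map_scaleR)
    also have "\<dots> = coordX n u" using pos by simp
    finally show ?thesis .
  qed
  then have u: "X.glue (regroupX x) = u"
    by - (rule X.coord_inject, simp add: coord_glue_regroupX)
  have qv: "q (coordY n (Y.glue (recoverY y))) = (1 / t) *\<^sub>R q (coordY (Suc n) y)" for n
    by (simp add: coord_glue_recoverY, simp add: recoverY_def map_scaleR map_diff map_add q_i)
  have "regroupY x n = coordY n y" for n
    using pos t_pos
    by (cases n) (simp_all add: regroupY_def Let_def p0 qv u, simp_all add: coord_glue_recoverY,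
      simp_all add: recoverY_def u_def map_scaleR)
  then show ?thesis
    unfolding x_def[symmetric] by - (rule Y.coord_inject, simp add: coord_glue_regroupY)
qed

end

lemma isomorphic_dist_le:
  "isomorphic scaleX scaleY \<and> banach_mazur_dist scaleX scaleY \<le> 9 + 6 * sqrt 3"
proof -
  define r b :: real where "r = sqrt 3 / 2" and "b = (sqrt 3 - 1) / 2"
  have s: "sqrt 3 * sqrt 3 = (3::real)" "sqrt 3 > (1::real)" by simp_all
  have pos: "r > 0" "b > 0" using s by (simp_all add: r_def b_def)
  \<comment> \<open>With these weights both bounds for the inverse equal \<open>3 + sqrt 3\<close>.\<close>
  have inv_b: "1 / b = sqrt 3 + 1"
    using s by (simp add: b_def field_simps)
  have inv_r: "2 / r = 4 / 3 * sqrt 3"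
    using s by (simp add: r_def field_simps)
  have inv_t: "1 / (2 + b) = 1 - sqrt 3 / 3"
  proof -
    have "(1 - sqrt 3 / 3) * (2 + b) = 1" using s by (simp add: b_def field_simps)
    moreover have "2 + b \<noteq> 0" using pos by simp
    ultimately show ?thesis by (simp add: divide_eq_eq)
  qed
  have B: "2 + 1 / b \<le> 3 + sqrt 3" "2 + 2 / r + 1 / (2 + b) \<le> 3 + sqrt 3"
    unfolding inv_b inv_r inv_t by simp_all
  have "isomorphic scaleX scaleY \<and>
    banach_mazur_dist scaleX scaleY \<le> (2 * r + 2 + b) * (3 + sqrt 3)"
  proof (rule banach_mazur_dist_le_of_inverse)
    let ?T = "\<lambda>x. Y.glue (regroupY r b (2 + b) x)" and ?S = "\<lambda>y. X.glue (recoverX r b (2 + b) y)"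
    show "Vector_Spaces.linear scaleX scaleY ?T" using pos by (rule linear_glue_regroupY) simp
    show "?S (?T x) = x" "?T (?S y) = y" for x y
      using pos by (simp_all add: recover_regroup regroup_recover)
    show "norm (?T x) \<le> (2 * r + 2 + b) * norm x" for x
      using pos by (intro Y.norm_glue_le norm_regroupY) simp_all
    show "norm (?S y) \<le> (3 + sqrt 3) * norm y" for y
      using pos B by (intro X.norm_glue_le norm_recoverX) simp_all
  qed (use pos in \<open>simp_all add: X.normed_space_axioms Y.normed_space_axioms\<close>)
  also have "(2 * r + 2 + b) * (3 + sqrt 3) = 9 + 6 * sqrt 3"
    using s by (simp add: r_def b_def field_simps)
  finally show ?thesis .
qed

end

section \<open>Generalized limits of bounded sequences\<close>

text \<open>
  By Tychonoff's theorem the evaluations \<open>a \<mapsto> a n\<close> have a cluster point \<open>\<Lambda>\<close> in the product, over all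
  bounded sequences \<open>a\<close>, of the compact closures of their ranges.  The traces on \<open>\<nat>\<close> of the
  neighbourhoods of \<open>\<Lambda>\<close> and the tails of \<open>\<nat>\<close> generate the filter, and \<open>\<Lambda> a\<close> is the limit of \<open>a\<close> along it.  Limits along
  one filter are automatically linear and contractive.
\<close>

lemma ex_convergent_filter:
  "\<exists>U :: nat filter. U \<le> sequentially \<and> U \<noteq> bot \<and>
     (\<forall>a :: nat \<Rightarrow> 'k::heine_borel. bounded (range a) \<longrightarrow> (\<exists>l. (a \<longlongrightarrow> l) U))"
proof -
  obtain z :: 'k where True by blast
  \<comment> \<open>An unbounded sequence gets the constant value \<open>z\<close>, so that every factor of the product is compact.\<close>
  define e where "e = (\<lambda>n (a :: nat \<Rightarrow> 'k). if bounded (range a) then a n else z)"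
  define S where "S = (\<lambda>a :: nat \<Rightarrow> 'k. if bounded (range a) then closure (range a) else {z})"
  have "compact (S a)" for a by (simp add: S_def compact_closure)
  then have "compactin (product_topology (\<lambda>_. euclidean) UNIV) (PiE UNIV S)"
    by (subst compactin_PiE) simp
  then have "compact (PiE UNIV S)" by (simp add: euclidean_product_topology)
  moreover have "e n \<in> PiE UNIV S" for n
    using closure_subset by (fastforce simp: e_def S_def)
  then have "eventually (\<lambda>x. x \<in> PiE UNIV S) (filtermap e sequentially)"
    by (simp add: eventually_filtermap)
  moreover have "filtermap e sequentially \<noteq> bot" by (simp add: filtermap_bot_iff)
  ultimately obtain \<Lambda> where cluster: "inf (nhds \<Lambda>) (filtermap e sequentially) \<noteq> bot"
    unfolding compact_filter by blast
  define U where "U = inf sequentially (filtercomap e (nhds \<Lambda>))"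
  have "U \<noteq> bot"
  proof
    assume "U = bot"
    then have "eventually (\<lambda>_. False) (inf sequentially (filtercomap e (nhds \<Lambda>)))"
      unfolding U_def by simp
    then obtain P Q where P: "eventually P sequentially" and Q: "eventually Q (filtercomap e (nhds \<Lambda>))"
      and PQ: "\<And>n. P n \<Longrightarrow> Q n \<Longrightarrow> False"
      unfolding eventually_inf by blast
    from Q obtain R where R: "eventually R (nhds \<Lambda>)" and RQ: "\<And>n. R (e n) \<Longrightarrow> Q n"
      unfolding eventually_filtercomap by blast
    have "eventually (\<lambda>x. \<not> R x) (filtermap e sequentially)"
      unfolding eventually_filtermap using P by (rule eventually_mono) (use PQ RQ in blast)
    with R have "eventually (\<lambda>_. False) (inf (nhds \<Lambda>) (filtermap e sequentially))"
      unfolding eventually_inf by blast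
    with cluster show False by (simp add: trivial_limit_def)
  qed
  moreover have "U \<le> sequentially" by (simp add: U_def)
  moreover have "(a \<longlongrightarrow> \<Lambda> a) U" if "bounded (range a)" for a :: "nat \<Rightarrow> 'k"
  proof -
    have lim: "(e \<longlongrightarrow> \<Lambda>) U"
      unfolding U_def by (rule filterlim_mono[OF filterlim_filtercomap]) auto
    have "continuous_on UNIV (\<lambda>x :: (nat \<Rightarrow> 'k) \<Rightarrow> 'k. x a)"
      by (rule continuous_on_product_then_coordinatewise[where f = "\<lambda>x. x"]) (rule continuous_on_id)
    then have "open ((\<lambda>x. x a) -` V)" if "open V" for V :: "'k set"
      using that by (intro open_vimage)
    then have "((\<lambda>n. e n a) \<longlongrightarrow> \<Lambda> a) U"
      using topological_tendstoD[OF lim] by (intro topological_tendstoI) fastforce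
    then show ?thesis using that by (simp add: e_def)
  qed
  ultimately show ?thesis by blast
qed

section \<open>Densities of Lipschitz functions\<close>

text \<open>
  Both sides are measures that give \<open>{a<..b}\<close> the value \<open>b - a\<close>.  What matters is the consequence
  that the Stieltjes measure of \<open>G\<close> lies below Lebesgue measure and so is absolutely continuous.
\<close>

lemma interval_measure_complement_sum:
  fixes G :: "real \<Rightarrow> real"
  assumes G: "mono G" and H: "mono (\<lambda>x. x - G x)" and cont: "continuous_on UNIV G"
    and A: "A \<in> sets borel"
  shows "emeasure (interval_measure G) A + emeasure (interval_measure (\<lambda>x. x - G x)) A
    = emeasure lborel A"
proof -
  let ?N = "interval_measure G" and ?N' = "interval_measure (\<lambda>x. x - G x)"
  define M where "M = measure_of UNIV (sets borel) (\<lambda>A. emeasure ?N A + emeasure ?N' A)"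
  have sets_M: "sets M = sets borel"
    unfolding M_def by (metis sets.sigma_sets_eq sets.space_closed sets_measure_of space_borel)
  have emeasure_M: "emeasure M B = emeasure ?N B + emeasure ?N' B" if "B \<in> sets borel" for B
  proof (rule emeasure_measure_of[OF M_def])
    show "countably_additive (sets M) (\<lambda>A. emeasure ?N A + emeasure ?N' A)"
      unfolding sets_M
    proof (rule countably_additiveI)
      fix B :: "nat \<Rightarrow> real set" assume "range B \<subseteq> sets borel" "disjoint_family B"
      then show "(\<Sum>i. emeasure ?N (B i) + emeasure ?N' (B i)) = emeasure ?N (\<Union>i. B i) + emeasure ?N' (\<Union>i. B i)"
        by (subst suminf_add[symmetric]) (auto simp: suminf_emeasure)
    qed
  qed (use that sets_M in \<open>auto simp: positive_def\<close>)
  have cont_r: "continuous (at_right a) G" "continuous (at_right a) (\<lambda>x. x - G x)" for a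
    using cont by (auto simp: continuous_on_eq_continuous_at intro!: continuous_intros
        intro: continuous_at_imp_continuous_at_within)
  have Ioc: "emeasure M {a<..b} = (if a \<le> b then ennreal (b - a) else 0)" for a b
  proof (cases "a \<le> b")
    case True
    have "emeasure M {a<..b} = ennreal (G b - G a) + ennreal (b - G b - (a - G a))"
      using True G H cont_r by (simp add: emeasure_M emeasure_interval_measure_Ioc mono_def)
    also have "\<dots> = ennreal (b - a)"
      using True monoD[OF G True] monoD[OF H True] by (subst ennreal_plus[symmetric]) auto
    finally show ?thesis using True by simp
  qed simp
  have "M = lborel"
  proof (rule measure_eqI_generator_eq)
    let ?E = "range (\<lambda>(a, b). {a<..b::real})"
    show "Int_stable ?E" by (force simp: Int_stable_def)
    show "emeasure M X = emeasure lborel X" if "X \<in> ?E" for X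
      using that by (auto simp: Ioc)
    show "sets M = sigma_sets UNIV ?E" "sets lborel = sigma_sets UNIV ?E"
      by (simp_all add: sets_M borel_sigma_sets_Ioc)
    show "range (\<lambda>i::nat. {- real i<..real i}) \<subseteq> ?E" by auto
    show "(\<Union>i::nat. {- real i<..real i}) = UNIV"
    proof (intro equalityI subsetI UNIV_I)
      fix x :: real
      obtain n where "\<bar>x\<bar> < real n" using reals_Archimedean2 by blast
      then show "x \<in> (\<Union>i::nat. {- real i<..real i})" by (auto intro!: exI[of _ n])
    qed
    show "emeasure M {- real i<..real i} \<noteq> \<infinity>" for i by (simp add: Ioc)
  qed simp
  with emeasure_M[OF A] show ?thesis by simp
qed

text \<open>
  The density is the Radon-Nikodym derivative of the Stieltjes measure of \<open>G\<close>.
\<close>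

lemma mono_has_density:
  fixes G :: "real \<Rightarrow> real"
  assumes G: "mono G" and H: "mono (\<lambda>x. x - G x)"
  shows "\<exists>g \<in> borel_measurable borel. \<forall>a b. a \<le> b \<longrightarrow> (g has_integral (G b - G a)) {a..b}"
proof -
  have lip: "\<bar>G x - G y\<bar> \<le> \<bar>x - y\<bar>" for x y
    using monoD[OF G, of x y] monoD[OF G, of y x] monoD[OF H, of x y] monoD[OF H, of y x] by linarith
  have cont: "continuous_on UNIV G"
    unfolding continuous_on_iff dist_real_def using lip by (meson order_le_less_trans)
  have cont_r: "continuous (at_right a) G" for a
    using cont by (auto simp: continuous_on_eq_continuous_at intro: continuous_at_imp_continuous_at_within)
  let ?N = "interval_measure G"
  have "emeasure ?N A \<le> emeasure lborel A" if "A \<in> sets borel" for A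
    by (subst interval_measure_complement_sum[OF G H cont that, symmetric]) simp
  then have "absolutely_continuous lborel ?N"
    by (auto simp: absolutely_continuous_def null_sets_def) (metis le_zero_eq)
  then obtain h where h[measurable]: "h \<in> borel_measurable borel" and N: "density lborel h = ?N"
    using sigma_finite_measure.Radon_Nikodym[OF sigma_finite_lborel, of ?N] by auto
  have "sigma_finite_measure (density lborel h)"
    unfolding N using G cont_r by (intro sigma_finite_interval_measure) (auto simp: mono_def)
  then have fin: "AE x in lborel. h x \<noteq> \<infinity>"
    using sigma_finite_measure.sigma_finite_iff_density_finite[OF sigma_finite_lborel, of h] by simp
  define g where "g = (\<lambda>x. enn2real (h x))"
  have g[measurable]: "g \<in> borel_measurable borel" unfolding g_def by measurable
  have "(g has_integral (G b - G a)) {a..b}" if ab: "a \<le> b" for a b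
  proof -
    have "(\<integral>\<^sup>+x. ennreal (if x \<in> {a..b} then g x else 0) \<partial>lborel) = (\<integral>\<^sup>+x. h x * indicator {a..b} x \<partial>lborel)"
      using fin by (intro nn_integral_cong_AE, eventually_elim)
        (auto simp: g_def indicator_def top.not_eq_extremum)
    also have "\<dots> = emeasure ?N {a..b}"
      by (subst N[symmetric]) (simp add: emeasure_density)
    also have "\<dots> = ennreal (G b - G a)"
      using G cont by (intro emeasure_interval_measure_Icc ab) (auto simp: mono_def)
    finally have "((\<lambda>x. if x \<in> {a..b} then g x else 0) has_integral (G b - G a)) UNIV"
      using monoD[OF G ab] by (intro nn_integral_has_integral) (auto simp: g_def)
    then show ?thesis by (simp only: has_integral_restrict_UNIV)
  qed
  with g show ?thesis by blast
qed

text \<open>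
  Adding a large linear function makes \<open>F\<close> increasing, and after rescaling its slope is at most 1.
\<close>

lemma lipschitz_real_has_density:
  fixes F :: "real \<Rightarrow> real"
  assumes lip: "\<And>s t. \<bar>F s - F t\<bar> \<le> C * \<bar>s - t\<bar>"
  shows "\<exists>f \<in> borel_measurable borel. \<forall>a b. a \<le> b \<longrightarrow> (f has_integral (F b - F a)) {a..b}"
proof -
  define K where "K = max C 1"
  have K: "K > 0" "K \<noteq> 0" by (simp_all add: K_def)
  have lip': "\<bar>F s - F t\<bar> \<le> K * \<bar>s - t\<bar>" for s t
    using lip[of s t] mult_right_mono[of C K "\<bar>s - t\<bar>"] by (simp add: K_def)
  define G where "G = (\<lambda>x. (F x + K * x) / (2 * K))"
  have "G x \<le> G y \<and> x - G x \<le> y - G y" if "x \<le> y" for x y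
  proof -
    have eq: "K * (x - G x) = (K * x - F x) / 2" "K * G x = (F x + K * x) / 2" for x
      using K by (simp_all add: G_def field_simps)
    have "K * \<bar>y - x\<bar> = K * y - K * x" using that by (simp add: algebra_simps)
    then have "K * G x \<le> K * G y" "K * (x - G x) \<le> K * (y - G y)"
      unfolding eq using lip'[of y x] by (simp_all add: abs_le_iff)
    then show ?thesis using K by simp
  qed
  then have "mono G" "mono (\<lambda>x. x - G x)" by (auto simp: mono_def)
  from mono_has_density[OF this] obtain g where g: "g \<in> borel_measurable borel"
    and int: "\<And>a b. a \<le> b \<Longrightarrow> (g has_integral (G b - G a)) {a..b}" by blast
  have "((\<lambda>x. 2 * K * g x - K) has_integral (F b - F a)) {a..b}" if "a \<le> b" for a b
  proof -
    have "((\<lambda>x. 2 * K * g x - K) has_integral (2 * K * (G b - G a) - (b - a) *\<^sub>R K)) {a..b}"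
      using that has_integral_const_real[of K a b]
      by (intro has_integral_diff has_integral_mult_right int) auto
    moreover have "2 * K * (G b - G a) - (b - a) *\<^sub>R K = F b - F a"
      using K by (simp add: G_def field_simps)
    ultimately show ?thesis by simp
  qed
  then show ?thesis using g by (intro bexI[of _ "\<lambda>x. 2 * K * g x - K"]) auto
qed

text \<open>
  By Lebesgue's differentiation theorem \<open>f x\<close> is, for almost every \<open>x\<close>, the limit of its averages
  over \<open>[x, x + h]\<close>.  The case \<open>C = 0\<close> says that a function with vanishing integrals is null.
\<close>

lemma AE_norm_le_of_integral_bound:
  fixes f :: "real \<Rightarrow> 'b::euclidean_space"
  assumes "\<And>a b. a \<le> b \<Longrightarrow> f integrable_on {a..b}"
    and bound: "\<And>a b. a \<le> b \<Longrightarrow> norm (integral {a..b} f) \<le> C * (b - a)"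
  shows "\<exists>N. negligible N \<and> (\<forall>x. x \<notin> N \<longrightarrow> norm (f x) \<le> C)"
proof -
  have "f integrable_on cbox a b" for a b
    using assms(1)[of a b] by (cases "a \<le> b") auto
  then obtain N where N: "negligible N"
    and lim: "\<And>x e. \<lbrakk>x \<notin> N; 0 < e\<rbrakk> \<Longrightarrow> \<exists>d>0. \<forall>h. 0 < h \<and> h < d \<longrightarrow>
        norm (integral (cbox x (x + h *\<^sub>R One)) f /\<^sub>R h ^ DIM(real) - f x) < e"
    using integrable_ccontinuous_explicit by metis
  have "norm (f x) \<le> C" if x: "x \<notin> N" for x
  proof (rule field_le_epsilon)
    fix e :: real assume "e > 0"
    from lim[OF x this] obtain d where "d > 0"
      and d: "\<And>h. 0 < h \<and> h < d \<Longrightarrow> norm (integral {x..x + h} f /\<^sub>R h - f x) < e"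
      by auto
    define h where "h = d / 2"
    have h: "0 < h" "h < d" using \<open>d > 0\<close> by (simp_all add: h_def)
    have "norm (integral {x..x + h} f /\<^sub>R h) \<le> C"
      using bound[of x "x + h"] h by (simp add: field_simps)
    moreover have "norm (f x) \<le> norm (integral {x..x + h} f /\<^sub>R h) + norm (integral {x..x + h} f /\<^sub>R h - f x)"
      by (metis norm_minus_commute norm_triangle_sub)
    ultimately show "norm (f x) \<le> C + e" using d[of h] h by simp
  qed
  with N show ?thesis by blast
qed

text \<open>
  The components have densities, and averages of the resulting density are difference quotients
  of \<open>F\<close>.  So it is bounded by \<open>C\<close> almost everywhere, and it can be changed on a null set to be
  bounded everywhere.  The sharp bound \<open>C\<close>, which componentwise estimates would lose, is what makes
  the left inverse of the averaging map a contraction.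
\<close>

lemma lipschitz_has_density:
  fixes F :: "real \<Rightarrow> 'b::euclidean_space"
  assumes lip: "\<And>s t. norm (F s - F t) \<le> C * \<bar>s - t\<bar>"
  shows "\<exists>f \<in> borel_measurable borel. (\<forall>x. norm (f x) \<le> C) \<and>
    (\<forall>a b. a \<le> b \<longrightarrow> (f has_integral (F b - F a)) {a..b})"
proof -
  have "\<exists>f \<in> borel_measurable borel. \<forall>s t. s \<le> t \<longrightarrow> (f has_integral (F t \<bullet> b - F s \<bullet> b)) {s..t}"
    if "b \<in> Basis" for b
  proof (rule lipschitz_real_has_density)
    show "\<bar>F s \<bullet> b - F t \<bullet> b\<bar> \<le> C * \<bar>s - t\<bar>" for s t
      using lip[of s t] Basis_le_norm[OF that, of "F s - F t"] by (simp add: inner_diff_left)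
  qed
  then obtain f where f: "\<And>b. b \<in> Basis \<Longrightarrow> f b \<in> borel_measurable borel"
    and int: "\<And>b s t. b \<in> Basis \<Longrightarrow> s \<le> t \<Longrightarrow> (f b has_integral (F t \<bullet> b - F s \<bullet> b)) {s..t}"
    by metis
  define g where "g = (\<lambda>x. \<Sum>b\<in>Basis. f b x *\<^sub>R b)"
  have g: "g \<in> borel_measurable borel"
    unfolding g_def using f by (intro borel_measurable_sum borel_measurable_scaleR) auto
  have int_g: "(g has_integral (F t - F s)) {s..t}" if "s \<le> t" for s t
  proof (rule has_integral_componentwise)
    fix b :: 'b assume "b \<in> Basis"
    then show "((\<lambda>x. g x \<bullet> b) has_integral (F t - F s) \<bullet> b) {s..t}"
      using int[OF _ that, of b] by (simp add: g_def inner_diff_left)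
  qed
  have "\<exists>N. negligible N \<and> (\<forall>x. x \<notin> N \<longrightarrow> norm (g x) \<le> C)"
  proof (rule AE_norm_le_of_integral_bound)
    show "norm (integral {a..b} g) \<le> C * (b - a)" if "a \<le> b" for a b
      using lip[of b a] that by (simp add: integral_unique[OF int_g])
  qed (use int_g in blast)
  then obtain N where N: "negligible N" "\<And>x. x \<notin> N \<Longrightarrow> norm (g x) \<le> C" by blast
  \<comment> \<open>The exceptional null set is removed without changing any integral.\<close>
  define h where "h = (\<lambda>x. if norm (g x) \<le> C then g x else 0)"
  have "0 \<le> C" using order_trans[OF norm_ge_zero lip[of 0 1]] by simp
  then have "norm (h x) \<le> C" for x by (simp add: h_def)
  moreover have "h \<in> borel_measurable borel" unfolding h_def using g by measurable
  moreover have "(h has_integral (F t - F s)) {s..t}" if "s \<le> t" for s t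
    by (rule has_integral_spike[OF N(1) _ int_g[OF that]]) (use N(2) in \<open>auto simp: h_def\<close>)
  ultimately show ?thesis by blast
qed

section \<open>Representatives of essentially bounded functions\<close>

lemma AE_unit_interval_iff:
  "(AE t in unit_interval_measure. P t) \<longleftrightarrow> (AE t in lebesgue. t \<in> {0..1} \<longrightarrow> P t)"
  by (subst AE_restrict_space_iff) auto

text \<open>
  A representative that is bounded by the norm at every point and vanishes off the unit
  interval.  It is Lebesgue measurable on the whole line, so affine substitutions and integrals
  over arbitrary intervals need no side conditions.
\<close>

definition Linf_fun :: "'k::{real_normed_field, euclidean_space} Linf \<Rightarrow> real \<Rightarrow> 'k" where
  "Linf_fun x t = (if t \<in> {0..1} \<and> norm (rep_Linf x t) \<le> norm x then rep_Linf x t else 0)"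

lemma Linf_rel_rep: "Linf_rel (rep_Linf x) (rep_Linf x)"
  by (rule Quotient_rep_reflp[OF Quotient_Linf])

lemma ess_bounded_rep: "ess_bounded (rep_Linf x)"
  using Linf_rel_rep[of x] by (simp add: Linf_rel_def)

lemma abs_rep_Linf: "abs_Linf (rep_Linf x) = x"
  by (rule Quotient_abs_rep[OF Quotient_Linf])

lemma abs_Linf_eqI:
  assumes "ess_bounded f" "ess_bounded g" "AE t in lebesgue. t \<in> {0..1} \<longrightarrow> f t = g t"
  shows "abs_Linf f = abs_Linf g"
  using assms Quotient_rel_abs[OF Quotient_Linf, of f g]
  by (simp add: Linf_rel_def AE_unit_interval_iff)

lemma rep_abs_Linf:
  assumes "ess_bounded f"
  shows "AE t in lebesgue. t \<in> {0..1} \<longrightarrow> rep_Linf (abs_Linf f) t = f t"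
  using Quotient_rep_abs[OF Quotient_Linf, of f] assms
  by (simp add: Linf_rel_def AE_unit_interval_iff)

lemma norm_Linf_rep: "norm x = real_of_ereal (ess_norm (rep_Linf x))"
  using norm_Linf.abs_eq[OF Linf_rel_rep[of x]] by (simp add: abs_rep_Linf)

lemma AE_Linf_fun_eq_rep: "AE t in lebesgue. t \<in> {0..1} \<longrightarrow> Linf_fun x t = rep_Linf x t"
  using ess_bounded_norm(3)[OF ess_bounded_rep[of x]]
  unfolding AE_unit_interval_iff norm_Linf_rep[symmetric]
  by eventually_elim (simp add: Linf_fun_def)

lemma norm_Linf_fun_le: "norm (Linf_fun x t) \<le> norm x"
  by (simp add: Linf_fun_def)

lemma Linf_fun_outside: "t \<notin> {0..1} \<Longrightarrow> Linf_fun x t = 0"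
  by (simp only: Linf_fun_def) simp

lemma Linf_fun_measurable: "Linf_fun x \<in> borel_measurable lebesgue"
proof -
  have [measurable]: "rep_Linf x \<in> borel_measurable unit_interval_measure"
    by (rule ess_bounded_measurable[OF ess_bounded_rep])
  have "(\<lambda>t. if norm (rep_Linf x t) \<le> norm x then rep_Linf x t else 0) \<in> borel_measurable unit_interval_measure"
    by measurable
  then have "(\<lambda>t. if t \<in> {0..1} then if norm (rep_Linf x t) \<le> norm x then rep_Linf x t else 0 else 0)
      \<in> borel_measurable lebesgue"
    by (intro borel_measurable_if_I) auto
  then show ?thesis by (rule back_subst[of "\<lambda>f. f \<in> _"]) (auto simp: Linf_fun_def)
qed

definition Linf_of :: "(real \<Rightarrow> 'k::{real_normed_field, euclidean_space}) \<Rightarrow> 'k Linf" where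
  "Linf_of f = abs_Linf f"

lemma
  assumes meas: "f \<in> borel_measurable lebesgue"
    and bound: "AE t in lebesgue. t \<in> {0..1} \<longrightarrow> norm (f t) \<le> C"
  shows AE_Linf_fun_Linf_of: "AE t in lebesgue. t \<in> {0..1} \<longrightarrow> Linf_fun (Linf_of f) t = f t"
    and norm_Linf_of_le: "norm (Linf_of f) \<le> C"
proof -
  have m: "f \<in> borel_measurable unit_interval_measure"
    using meas by (rule measurable_restrict_space1)
  have b: "AE t in unit_interval_measure. norm (f t) \<le> C"
    using bound by (simp add: AE_unit_interval_iff)
  have f: "ess_bounded f" using m b by (rule ess_boundedI)
  show "AE t in lebesgue. t \<in> {0..1} \<longrightarrow> Linf_fun (Linf_of f) t = f t"
    using AE_Linf_fun_eq_rep[of "abs_Linf f"] rep_abs_Linf[OF f] unfolding Linf_of_def by eventually_elim simp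
  have "Linf_rel f f" using f by (simp add: Linf_rel_def)
  then show "norm (Linf_of f) \<le> C"
    using ess_norm_le_real[OF m b] by (simp add: Linf_of_def norm_Linf.abs_eq)
qed

lemma ess_bounded_Linf_fun: "ess_bounded (Linf_fun x)"
  by (rule ess_boundedI[OF measurable_restrict_space1[OF Linf_fun_measurable], where C = "norm x"])
    (simp add: norm_Linf_fun_le)

lemma Linf_of_Linf_fun: "Linf_of (Linf_fun x) = x"
  unfolding Linf_of_def
  by (subst (2) abs_rep_Linf[symmetric], rule abs_Linf_eqI[OF ess_bounded_Linf_fun ess_bounded_rep AE_Linf_fun_eq_rep])

lemma norm_le_fnI:
  assumes "AE t in lebesgue. t \<in> {0..1} \<longrightarrow> norm (Linf_fun x t) \<le> C"
  shows "norm x \<le> C"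
  using norm_Linf_of_le[OF Linf_fun_measurable assms] by (simp add: Linf_of_Linf_fun)

lemma Linf_eqI:
  assumes "AE t in lebesgue. t \<in> {0..1} \<longrightarrow> Linf_fun x t = Linf_fun y t"
  shows "x = y"
  using abs_Linf_eqI[OF ess_bounded_Linf_fun ess_bounded_Linf_fun assms] Linf_of_Linf_fun unfolding Linf_of_def by metis

lemma AE_Linf_fun_add: "AE t in lebesgue. Linf_fun (x + y) t = Linf_fun x t + Linf_fun y t"
proof -
  have "Linf_rel (rep_Linf x) (rep_Linf x)" "Linf_rel (rep_Linf y) (rep_Linf y)"
    by (rule Linf_rel_rep)+
  then have eq: "x + y = abs_Linf (\<lambda>t. rep_Linf x t + rep_Linf y t)"
    using plus_Linf.abs_eq[of "rep_Linf x" "rep_Linf y"] by (simp add: abs_rep_Linf)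
  have "AE t in lebesgue. t \<in> {0..1} \<longrightarrow> rep_Linf (x + y) t = rep_Linf x t + rep_Linf y t"
    unfolding eq by (intro rep_abs_Linf ess_bounded_add_norm ess_bounded_rep)
  with AE_Linf_fun_eq_rep[of "x + y"] AE_Linf_fun_eq_rep[of x] AE_Linf_fun_eq_rep[of y] show ?thesis
  proof eventually_elim
    case (elim t)
    then show ?case by (cases "t \<in> {0..1}") (simp_all add: Linf_fun_outside)
  qed
qed

lemma AE_Linf_fun_scale: "AE t in lebesgue. Linf_fun (Linf_scale c x) t = c * Linf_fun x t"
proof -
  have eq: "Linf_scale c x = abs_Linf (\<lambda>t. c * rep_Linf x t)"
    using Linf_scale.abs_eq[OF Linf_rel_rep[of x], of c] by (simp add: abs_rep_Linf)
  have "AE t in lebesgue. t \<in> {0..1} \<longrightarrow> rep_Linf (Linf_scale c x) t = c * rep_Linf x t"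
    unfolding eq by (intro rep_abs_Linf ess_bounded_scale_norm ess_bounded_rep)
  with AE_Linf_fun_eq_rep[of "Linf_scale c x"] AE_Linf_fun_eq_rep[of x] show ?thesis
  proof eventually_elim
    case (elim t)
    then show ?case by (cases "t \<in> {0..1}") (simp_all add: Linf_fun_outside)
  qed
qed

section \<open>Essentially bounded functions as bounded sequences of such functions\<close>

lemma AE_lebesgue_affine:
  fixes a c :: real
  assumes "AE u in lebesgue. P u" and c: "c \<noteq> 0"
  shows "AE t in lebesgue. P (a + c * t)"
proof -
  obtain N where N: "negligible N" "{u. \<not> P u} \<subseteq> N"
    using assms(1) by (auto simp: eventually_ae_filter_negligible)
  have "negligible ((\<lambda>u. (u - a) * (1 / c)) ` N)"
    using N(1) c by (intro negligible_differentiable_image_negligible differentiable_on_mult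
        differentiable_on_diff differentiable_on_ident differentiable_on_const) auto
  moreover have "{t. \<not> P (a + c * t)} \<subseteq> (\<lambda>u. (u - a) * (1 / c)) ` N"
  proof
    fix t assume "t \<in> {t. \<not> P (a + c * t)}"
    then have "a + c * t \<in> N" using N(2) by auto
    moreover have "t = (a + c * t - a) * (1 / c)" using c by simp
    ultimately show "t \<in> (\<lambda>u. (u - a) * (1 / c)) ` N" by (rule rev_image_eqI)
  qed
  ultimately show ?thesis by (auto simp: eventually_ae_filter_negligible)
qed

lemma lebesgue_measurable_affine:
  fixes a c :: real
  assumes "f \<in> borel_measurable lebesgue" and "c \<noteq> 0"
  shows "(\<lambda>t. f (a + c * t)) \<in> borel_measurable lebesgue"
proof -
  have "(\<lambda>t. a + c * t) \<in> lebesgue \<rightarrow>\<^sub>M lebesgue"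
    using lebesgue_affine_measurable[of "\<lambda>_. c" a] assms(2) by (simp add: mult.commute)
  from measurable_compose[OF this assms(1)] show ?thesis .
qed

text \<open>
  The interval \<open>[2\<^sup>-\<^sup>n\<^sup>-\<^sup>1, 2\<^sup>-\<^sup>n]\<close> is the image of \<open>[0, 1]\<close> under \<open>t \<mapsto> 2\<^sup>-\<^sup>n\<^sup>-\<^sup>1 + 2\<^sup>-\<^sup>n\<^sup>-\<^sup>1 t\<close>.
\<close>

definition Linf_coord :: "nat \<Rightarrow> 'k::{real_normed_field, euclidean_space} Linf \<Rightarrow> 'k Linf" where
  "Linf_coord n x = Linf_of (\<lambda>t. Linf_fun x (1 / 2 ^ Suc n + 1 / 2 ^ Suc n * t))"

lemma Linf_fun_piece_measurable:
  "(\<lambda>t. Linf_fun x (1 / 2 ^ Suc n + 1 / 2 ^ Suc n * t)) \<in> borel_measurable lebesgue"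
  by (rule lebesgue_measurable_affine[OF Linf_fun_measurable]) simp

lemma AE_Linf_fun_Linf_coord:
  "AE t in lebesgue. t \<in> {0..1} \<longrightarrow> Linf_fun (Linf_coord n x) t = Linf_fun x (1 / 2 ^ Suc n + 1 / 2 ^ Suc n * t)"
  unfolding Linf_coord_def
  by (rule AE_Linf_fun_Linf_of[OF Linf_fun_piece_measurable, where C = "norm x"]) (simp add: norm_Linf_fun_le)

lemma inverse_piece: "1 / 2 ^ Suc n + 1 / 2 ^ Suc n * (- 1 + 2 ^ Suc n * u) = (u :: real)"
  by (simp add: field_simps)

lemma piece_inverse: "- 1 + 2 ^ Suc n * (1 / 2 ^ Suc n + 1 / 2 ^ Suc n * t) = (t :: real)"
  by (simp add: field_simps)

text \<open>
  The least \<open>n\<close> with \<open>2\<^sup>-\<^sup>n\<^sup>-\<^sup>1 < u\<close> picks the half-open piece \<open>(2\<^sup>-\<^sup>n\<^sup>-\<^sup>1, 2\<^sup>-\<^sup>n]\<close> containing \<open>u\<close>.  The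
  common end points of neighbouring pieces thus go to the left one, which is immaterial up to null sets.
\<close>

definition piece_index :: "real \<Rightarrow> nat" where
  "piece_index u = (LEAST n. 1 / 2 ^ Suc n < u)"

lemma piece_index_bounds:
  assumes "0 < u" "u \<le> 1"
  shows "- 1 + 2 ^ Suc (piece_index u) * u \<in> {0..1}"
proof -
  obtain m where "(1 / 2) ^ m < u" using real_arch_pow_inv[OF assms(1), of "1/2"] by auto
  moreover have "1 / 2 ^ Suc m \<le> (1 / 2 :: real) ^ m" by (simp add: power_one_over field_simps)
  ultimately have ex: "1 / 2 ^ Suc m < u" by linarith
  have lower: "1 / 2 ^ Suc (piece_index u) < u"
    unfolding piece_index_def by (rule LeastI[of "\<lambda>n. 1 / 2 ^ Suc n < u", OF ex])
  have upper: "u \<le> 1 / 2 ^ piece_index u"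
  proof (cases "piece_index u")
    case (Suc k)
    then have "k < piece_index u" by simp
    then have "\<not> 1 / 2 ^ Suc k < u" unfolding piece_index_def by (rule not_less_Least)
    then show ?thesis by (simp add: Suc)
  qed (use assms in simp)
  show ?thesis using lower upper by (simp add: field_simps)
qed

lemma piece_index_piece:
  assumes "0 < t" "t \<le> 1"
  shows "piece_index (1 / 2 ^ Suc n + 1 / 2 ^ Suc n * t) = n"
  unfolding piece_index_def
proof (rule Least_equality)
  show "1 / 2 ^ Suc n < 1 / 2 ^ Suc n + 1 / 2 ^ Suc n * t" using assms by simp
  fix m assume m: "1 / 2 ^ Suc m < 1 / 2 ^ Suc n + 1 / 2 ^ Suc n * t"
  show "n \<le> m"
  proof (rule ccontr)
    assume "\<not> n \<le> m"
    then have "Suc m \<le> n" by simp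
    then have "(1::real) / 2 ^ n \<le> 1 / 2 ^ Suc m"
      by (intro divide_left_mono power_increasing) auto
    moreover have "1 / 2 ^ Suc n + 1 / 2 ^ Suc n * t \<le> 1 / 2 ^ n"
      using assms by (simp add: field_simps)
    ultimately show False using m by linarith
  qed
qed

lemma AE_lebesgue_neq: "AE t in lebesgue. t \<noteq> (a :: real)"
  by (auto simp: eventually_ae_filter_negligible intro!: exI[of _ "{a}"])

interpretation Linf_power: self_power Linf_scale
  "Linf_coord :: nat \<Rightarrow> 'k::{real_normed_field, euclidean_space} Linf \<Rightarrow> 'k Linf"
proof unfold_locales
  fix n :: nat and x y :: "'k Linf" and c :: 'k
  show "Linf_coord n (x + y) = Linf_coord n x + Linf_coord n y"
  proof (rule Linf_eqI)
    have "AE t in lebesgue. Linf_fun (x + y) (1 / 2 ^ Suc n + 1 / 2 ^ Suc n * t)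
      = Linf_fun x (1 / 2 ^ Suc n + 1 / 2 ^ Suc n * t) + Linf_fun y (1 / 2 ^ Suc n + 1 / 2 ^ Suc n * t)"
      by (rule AE_lebesgue_affine[OF AE_Linf_fun_add]) simp
    with AE_Linf_fun_add[of "Linf_coord n x" "Linf_coord n y"]
      AE_Linf_fun_Linf_coord[of n "x + y"] AE_Linf_fun_Linf_coord[of n x] AE_Linf_fun_Linf_coord[of n y]
    show "AE t in lebesgue. t \<in> {0..1} \<longrightarrow> Linf_fun (Linf_coord n (x + y)) t = Linf_fun (Linf_coord n x + Linf_coord n y) t"
      by eventually_elim simp
  qed
  show "Linf_coord n (Linf_scale c x) = Linf_scale c (Linf_coord n x)"
  proof (rule Linf_eqI)
    have "AE t in lebesgue. Linf_fun (Linf_scale c x) (1 / 2 ^ Suc n + 1 / 2 ^ Suc n * t)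
      = c * Linf_fun x (1 / 2 ^ Suc n + 1 / 2 ^ Suc n * t)"
      by (rule AE_lebesgue_affine[OF AE_Linf_fun_scale]) simp
    with AE_Linf_fun_scale[of c "Linf_coord n x"] AE_Linf_fun_Linf_coord[of n "Linf_scale c x"] AE_Linf_fun_Linf_coord[of n x]
    show "AE t in lebesgue. t \<in> {0..1} \<longrightarrow> Linf_fun (Linf_coord n (Linf_scale c x)) t = Linf_fun (Linf_scale c (Linf_coord n x)) t"
      by eventually_elim simp
  qed
  show "norm (Linf_coord n x) \<le> norm x"
    unfolding Linf_coord_def by (rule norm_Linf_of_le[OF Linf_fun_piece_measurable]) (simp add: norm_Linf_fun_le)
next
  fix x :: "'k Linf" and C
  assume bound: "\<And>n. norm (Linf_coord n x) \<le> C"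
  have "AE u in lebesgue. - 1 + 2 ^ Suc n * u \<in> {0..1} \<longrightarrow> norm (Linf_fun x u) \<le> C" for n
  proof -
    have "AE t in lebesgue. t \<in> {0..1} \<longrightarrow> norm (Linf_fun x (1 / 2 ^ Suc n + 1 / 2 ^ Suc n * t)) \<le> C"
      using AE_Linf_fun_Linf_coord[of n x]
      by eventually_elim (metis bound norm_Linf_fun_le order_trans)
    from AE_lebesgue_affine[OF this, of "2 ^ Suc n" "- 1"] show ?thesis
      unfolding inverse_piece by simp
  qed
  then have "AE u in lebesgue. \<forall>n. - 1 + 2 ^ Suc n * u \<in> {0..1} \<longrightarrow> norm (Linf_fun x u) \<le> C"
    by (subst AE_all_countable) blast
  with AE_lebesgue_neq[of 0] show "norm x \<le> C"
  proof (intro norm_le_fnI, eventually_elim, intro impI)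
    fix u :: real
    assume "u \<noteq> 0" "u \<in> {0..1}" and *: "\<forall>n. - 1 + 2 ^ Suc n * u \<in> {0..1} \<longrightarrow> norm (Linf_fun x u) \<le> C"
    then have "- 1 + 2 ^ Suc (piece_index u) * u \<in> {0..1}" by (intro piece_index_bounds) auto
    with * show "norm (Linf_fun x u) \<le> C" by blast
  qed
next
  fix s :: "nat \<Rightarrow> 'k Linf" and C
  assume bound: "\<And>n. norm (s n) \<le> C"
  define g where "g = (\<lambda>u. Linf_fun (s (piece_index u)) (- 1 + 2 ^ Suc (piece_index u) * u))"
  have g: "g \<in> borel_measurable lebesgue"
    unfolding g_def
  proof (rule measurable_compose_countable[where g = piece_index
        and f = "\<lambda>n u. Linf_fun (s n) (- 1 + 2 ^ Suc n * u)"])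
    show "(\<lambda>u. Linf_fun (s n) (- 1 + 2 ^ Suc n * u)) \<in> borel_measurable lebesgue" for n
      by (rule lebesgue_measurable_affine[OF Linf_fun_measurable]) simp
    have "Measurable.pred lebesgue (\<lambda>u :: real. 1 / 2 ^ Suc i < u)" for i
      using borel_open[OF open_greaterThan[of "1 / 2 ^ Suc i :: real"]]
      by (simp add: pred_def greaterThan_def)
    then show "piece_index \<in> lebesgue \<rightarrow>\<^sub>M count_space UNIV"
      unfolding piece_index_def[abs_def] by (rule measurable_Least)
  qed
  have gC: "norm (g u) \<le> C" for u
    unfolding g_def using bound norm_Linf_fun_le order_trans by blast
  have "Linf_coord n (Linf_of g) = s n" for n
  proof (rule Linf_eqI)
    have "AE u in lebesgue. u \<in> {0..1} \<longrightarrow> Linf_fun (Linf_of g) u = g u"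
      by (rule AE_Linf_fun_Linf_of[OF g, where C = C]) (simp add: gC)
    then have "AE t in lebesgue. 1 / 2 ^ Suc n + 1 / 2 ^ Suc n * t \<in> {0..1} \<longrightarrow>
      Linf_fun (Linf_of g) (1 / 2 ^ Suc n + 1 / 2 ^ Suc n * t) = g (1 / 2 ^ Suc n + 1 / 2 ^ Suc n * t)"
      by (rule AE_lebesgue_affine) simp
    with AE_Linf_fun_Linf_coord[of n "Linf_of g"] AE_lebesgue_neq[of 0]
    show "AE t in lebesgue. t \<in> {0..1} \<longrightarrow> Linf_fun (Linf_coord n (Linf_of g)) t = Linf_fun (s n) t"
    proof eventually_elim
      case (elim t)
      show ?case
      proof
        assume t: "t \<in> {0..1}"
        then have t': "0 < t" "t \<le> 1" using elim by auto
        have "1 / 2 ^ Suc n + 1 / 2 ^ Suc n * t \<le> 1 / 2 ^ n" using t' by (simp add: field_simps)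
        also have "\<dots> \<le> (1::real)" by (simp add: divide_le_eq_1)
        finally have "1 / 2 ^ Suc n + 1 / 2 ^ Suc n * t \<in> {0..1}" using t' by simp
        moreover have "g (1 / 2 ^ Suc n + 1 / 2 ^ Suc n * t) = Linf_fun (s n) t"
          unfolding g_def piece_index_piece[OF t'] piece_inverse ..
        ultimately show "Linf_fun (Linf_coord n (Linf_of g)) t = Linf_fun (s n) t" using elim t by simp
      qed
    qed
  qed
  then show "\<exists>x. \<forall>n. Linf_coord n x = s n" by blast
qed

section \<open>Bounded sequences as bounded sequences of bounded sequences\<close>

lemma apply_Bcontfun_seq:
  assumes "\<And>n :: nat. norm (f n) \<le> C"
  shows "apply_bcontfun (Bcontfun f) n = f n"
  using assms by (subst Bcontfun_inverse) (auto simp: bounded_sequence_in_bcontfun intro: boundedI)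

definition ell_coord :: "nat \<Rightarrow> 'k::real_normed_field ell_infty \<Rightarrow> 'k ell_infty" where
  "ell_coord n a = Bcontfun (\<lambda>k. apply_bcontfun a (prod_encode (n, k)))"

lemma apply_ell_coord: "apply_bcontfun (ell_coord n a) k = apply_bcontfun a (prod_encode (n, k))"
  unfolding ell_coord_def by (rule apply_Bcontfun_seq) (rule norm_bounded)

interpretation ell_power: self_power ell_infty_scale
  "ell_coord :: nat \<Rightarrow> 'k::real_normed_field ell_infty \<Rightarrow> 'k ell_infty"
proof unfold_locales
  fix n :: nat and a b :: "'k ell_infty" and c :: 'k
  show "ell_coord n (a + b) = ell_coord n a + ell_coord n b"
    by (rule bcontfun_eqI) (simp add: apply_ell_coord)
  show "ell_coord n (ell_infty_scale c a) = ell_infty_scale c (ell_coord n a)"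
    by (rule bcontfun_eqI) (simp add: apply_ell_coord)
  show "norm (ell_coord n a) \<le> norm a"
    by (rule norm_bound) (simp add: apply_ell_coord norm_bounded)
next
  fix a :: "'k ell_infty" and C
  assume bound: "\<And>n. norm (ell_coord n a) \<le> C"
  show "norm a \<le> C"
  proof (rule norm_bound)
    fix m
    obtain n k where m: "m = prod_encode (n, k)" by (metis prod_decode_inverse surj_pair)
    show "norm (apply_bcontfun a m) \<le> C"
      using order_trans[OF norm_bounded bound, of n k] by (simp add: m apply_ell_coord)
  qed
next
  fix s :: "nat \<Rightarrow> 'k ell_infty" and C
  assume bound: "\<And>n. norm (s n) \<le> C"
  define f where "f = (\<lambda>m. case prod_decode m of (n, k) \<Rightarrow> apply_bcontfun (s n) k)"
  have "norm (f m) \<le> C" for m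
    using order_trans[OF norm_bounded bound] by (simp add: f_def split: prod.split)
  then have "apply_bcontfun (Bcontfun f) m = f m" for m by (rule apply_Bcontfun_seq)
  then have "ell_coord n (Bcontfun f) = s n" for n
    by (intro bcontfun_eqI) (simp add: apply_ell_coord f_def)
  then show "\<exists>a. \<forall>n. ell_coord n a = s n" by blast
qed

section \<open>Integrals of essentially bounded functions\<close>

lemma integral_AE_cong:
  fixes f g :: "real \<Rightarrow> 'b::euclidean_space"
  assumes "AE t in lebesgue. t \<in> S \<longrightarrow> f t = g t"
  shows "integral S f = integral S g"
proof -
  obtain N where N: "negligible N" "{t. \<not> (t \<in> S \<longrightarrow> f t = g t)} \<subseteq> N"
    using assms by (auto simp: eventually_ae_filter_negligible)
  show ?thesis by (rule integral_spike[OF N(1)]) (use N(2) in auto)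
qed

lemma Linf_fun_integrable: "Linf_fun x integrable_on {a..b}"
  by (rule measurable_bounded_by_integrable_imp_integrable[where g = "\<lambda>_. norm x"])
    (auto simp: norm_Linf_fun_le intro: measurable_restrict_space1[OF Linf_fun_measurable])

lemma norm_integral_Linf_fun_le: "a \<le> b \<Longrightarrow> norm (integral {a..b} (Linf_fun x)) \<le> norm x * (b - a)"
  using integral_norm_bound_integral[OF Linf_fun_integrable[of x a b], of "\<lambda>_. norm x"]
  by (auto simp: norm_Linf_fun_le mult.commute)

lemma integral_Linf_fun_add: "integral {a..b} (Linf_fun (x + y)) = integral {a..b} (Linf_fun x) + integral {a..b} (Linf_fun y)"
proof -
  have "integral {a..b} (Linf_fun (x + y)) = integral {a..b} (\<lambda>t. Linf_fun x t + Linf_fun y t)"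
    by (rule integral_AE_cong) (use AE_Linf_fun_add[of x y] in eventually_elim, simp)
  then show ?thesis by (simp add: integral_add Linf_fun_integrable)
qed

lemma integral_Linf_fun_scale: "integral {a..b} (Linf_fun (Linf_scale c x)) = c * integral {a..b} (Linf_fun x)"
proof -
  have "integral {a..b} (Linf_fun (Linf_scale c x)) = integral {a..b} (\<lambda>t. c * Linf_fun x t)"
    by (rule integral_AE_cong) (use AE_Linf_fun_scale[of c x] in eventually_elim, simp)
  then show ?thesis by simp
qed

text \<open>
  An element of \<open>L\<^sub>\<infinity>\<close> is determined by its primitive.  This yields both the linearity of the weak
  limit and the fact that it inverts the averaging map.
\<close>

lemma Linf_eqI_integral:
  assumes "\<And>s t. 0 \<le> s \<Longrightarrow> s \<le> t \<Longrightarrow> t \<le> 1 \<Longrightarrow> integral {s..t} (Linf_fun x) = integral {s..t} (Linf_fun y)"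
  shows "x = y"
proof -
  define f where "f = (\<lambda>t. Linf_fun x t - Linf_fun y t)"
  have "integral {a..b} f = 0" for a b
  proof -
    have f: "f = (\<lambda>t. if t \<in> {0..1} then f t else 0)"
      by (auto simp: f_def Linf_fun_outside fun_eq_iff)
    have "integral {a..b} f = integral {max 0 a..min 1 b} f"
      by (subst f) (simp only: integral_restrict_Int Int_atLeastAtMost)
    also have "\<dots> = 0"
    proof (cases "max 0 a \<le> min 1 b")
      case True
      then show ?thesis using assms[of "max 0 a" "min 1 b"]
        unfolding f_def by (subst integral_diff) (auto simp: Linf_fun_integrable)
    qed simp
    finally show ?thesis .
  qed
  then obtain N where N: "negligible N" "\<And>t. t \<notin> N \<Longrightarrow> norm (f t) \<le> 0"
    using AE_norm_le_of_integral_bound[of f 0]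
    by (auto simp: f_def integrable_diff Linf_fun_integrable)
  show ?thesis
  proof (rule Linf_eqI)
    show "AE t in lebesgue. t \<in> {0..1} \<longrightarrow> Linf_fun x t = Linf_fun y t"
      using N by (auto simp: eventually_ae_filter_negligible f_def)
  qed
qed

section \<open>Bounded sequences as functions constant on the pieces\<close>

definition Linf_const :: "'k::{real_normed_field, euclidean_space} \<Rightarrow> 'k Linf" where
  "Linf_const c = Linf_scale c (Linf_of (\<lambda>_. 1))"

lemma norm_one_le: "norm (Linf_of (\<lambda>_. 1) :: 'k::{real_normed_field, euclidean_space} Linf) \<le> 1"
  by (rule norm_Linf_of_le) auto

lemma norm_Linf_const_le: "norm (Linf_const c) \<le> norm c"
  using mult_left_mono[OF norm_one_le, of "norm c"] by (simp add: Linf_const_def Linf.norm_scale)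

lemma integral_Linf_const: "integral {0..1} (Linf_fun (Linf_const c)) = c"
proof -
  have "integral {0..1} (Linf_fun (Linf_of (\<lambda>_. 1 :: 'a))) = integral {0..1::real} (\<lambda>_. 1 :: 'a)"
    by (rule integral_AE_cong, rule AE_Linf_fun_Linf_of[where C = 1]) auto
  then show ?thesis by (simp add: Linf_const_def integral_Linf_fun_scale)
qed

definition block_embedding :: "'k::{real_normed_field, euclidean_space} ell_infty \<Rightarrow> 'k Linf" where
  "block_embedding a = Linf_power.glue (\<lambda>n. Linf_const (apply_bcontfun a n))"

definition block_means :: "'k::{real_normed_field, euclidean_space} Linf \<Rightarrow> 'k ell_infty" where
  "block_means x = Bcontfun (\<lambda>n. integral {0..1} (Linf_fun (Linf_coord n x)))"

lemma norm_Linf_const_apply_le: "norm (Linf_const (apply_bcontfun a n)) \<le> norm a"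
  using norm_Linf_const_le norm_bounded order_trans by blast

lemma Linf_coord_block_embedding: "Linf_coord n (block_embedding a) = Linf_const (apply_bcontfun a n)"
  unfolding block_embedding_def by (rule Linf_power.coord_glue) (rule norm_Linf_const_apply_le)

lemma norm_mean_Linf_coord_le: "norm (integral {0..1} (Linf_fun (Linf_coord n x))) \<le> norm x"
  using norm_integral_Linf_fun_le[of 0 1 "Linf_coord n x"] Linf_power.norm_coord_le[of n x] by simp

lemma apply_block_means: "apply_bcontfun (block_means x) n = integral {0..1} (Linf_fun (Linf_coord n x))"
  unfolding block_means_def by (rule apply_Bcontfun_seq) (rule norm_mean_Linf_coord_le)

lemma linear_block_embedding: "Vector_Spaces.linear ell_infty_scale Linf_scale block_embedding"
proof (unfold Vector_Spaces.linear_iff, intro conjI allI)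
  show "block_embedding (a + b) = block_embedding a + block_embedding b" for a b
    by (rule Linf_power.coord_inject) (simp add: Linf_coord_block_embedding Linf_power.coord_add Linf_const_def Linf_scale_simps)
  show "block_embedding (ell_infty_scale c a) = Linf_scale c (block_embedding a)" for c a
    by (rule Linf_power.coord_inject) (simp add: Linf_coord_block_embedding Linf_power.coord_scale Linf_const_def Linf_scale_simps)
qed (fact ell_infty.vector_space_axioms Linf.vector_space_axioms)+

lemma linear_block_means: "Vector_Spaces.linear Linf_scale ell_infty_scale block_means"
proof (unfold Vector_Spaces.linear_iff, intro conjI allI)
  show "block_means (x + y) = block_means x + block_means y" for x y
    by (rule bcontfun_eqI) (simp add: apply_block_means Linf_power.coord_add integral_Linf_fun_add)
  show "block_means (Linf_scale c x) = ell_infty_scale c (block_means x)" for c x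
    by (rule bcontfun_eqI) (simp add: apply_block_means Linf_power.coord_scale integral_Linf_fun_scale)
qed (fact ell_infty.vector_space_axioms Linf.vector_space_axioms)+

lemma norm_block_embedding_le: "norm (block_embedding a) \<le> norm a"
  unfolding block_embedding_def by (rule Linf_power.norm_glue_le) (rule norm_Linf_const_apply_le)

lemma norm_block_means_le: "norm (block_means x) \<le> norm x"
  by (rule norm_bound) (simp add: apply_block_means norm_mean_Linf_coord_le)

lemma block_means_block_embedding: "block_means (block_embedding a) = a"
  by (rule bcontfun_eqI) (simp add: apply_block_means Linf_coord_block_embedding integral_Linf_const)

section \<open>Essentially bounded functions as sequences of averages\<close>

definition averages :: "'k::{real_normed_field, euclidean_space} Linf \<Rightarrow> 'k ell_infty" where
  "averages x = Bcontfun (\<lambda>m. case prod_decode m of (n, k) \<Rightarrow>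
     (real n + 1) *\<^sub>R integral {real k / (real n + 1)..(real k + 1) / (real n + 1)} (Linf_fun x))"

lemma norm_average_le:
  "norm ((real n + 1) *\<^sub>R integral {real k / (real n + 1)..(real k + 1) / (real n + 1)} (Linf_fun x)) \<le> norm x"
  (is "norm (_ *\<^sub>R ?I) \<le> _")
proof -
  have "norm ?I \<le> norm x * (1 / (real n + 1))"
    using norm_integral_Linf_fun_le[of "real k / (real n + 1)" "(real k + 1) / (real n + 1)" x]
    by (simp add: divide_right_mono flip: diff_divide_distrib)
  then show ?thesis unfolding norm_scaleR by (simp add: field_simps)
qed

lemma apply_averages: "apply_bcontfun (averages x) (prod_encode (n, k)) =
  (real n + 1) *\<^sub>R integral {real k / (real n + 1)..(real k + 1) / (real n + 1)} (Linf_fun x)"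
  unfolding averages_def
  by (subst apply_Bcontfun_seq[where C = "norm x"]) (auto split: prod.split simp del: norm_scaleR intro: norm_average_le)

lemma norm_averages_le: "norm (averages x) \<le> norm x"
proof (rule norm_bound)
  fix m
  obtain n k where m: "m = prod_encode (n, k)" by (metis prod_decode_inverse surj_pair)
  show "norm (apply_bcontfun (averages x) m) \<le> norm x" unfolding m apply_averages by (rule norm_average_le)
qed

lemma ell_infty_eqI_prod:
  "(\<And>n k. apply_bcontfun a (prod_encode (n, k)) = apply_bcontfun b (prod_encode (n, k))) \<Longrightarrow> a = b"
  by (rule bcontfun_eqI) (metis prod_decode_inverse surj_pair)

lemma linear_averages: "Vector_Spaces.linear Linf_scale ell_infty_scale averages"
proof (unfold Vector_Spaces.linear_iff, intro conjI allI)
  show "averages (x + y) = averages x + averages y" for x y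
    by (rule ell_infty_eqI_prod) (simp add: apply_averages integral_Linf_fun_add scaleR_add_right)
  show "averages (Linf_scale c x) = ell_infty_scale c (averages x)" for c x
    by (rule ell_infty_eqI_prod) (simp add: apply_averages integral_Linf_fun_scale)
qed (fact ell_infty.vector_space_axioms Linf.vector_space_axioms)+

text \<open>
  The sequence \<open>a\<close> is read as step functions, the \<open>n\<close>-th one having the value \<open>a (n, k)\<close> on
  \<open>[k/(n+1), (k+1)/(n+1)]\<close>.  At the grid points \<open>k/(n+1)\<close> the value below is the primitive of the
  \<open>n\<close>-th step function; rounding \<open>t\<close> down to the grid keeps it a finite sum, at an error that
  vanishes as \<open>n\<close> grows.
\<close>

definition step_primitive :: "'k::{real_normed_field, euclidean_space} ell_infty \<Rightarrow> nat \<Rightarrow> real \<Rightarrow> 'k" where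
  "step_primitive a n t =
     (\<Sum>k<nat \<lfloor>(real n + 1) * t\<rfloor>. apply_bcontfun a (prod_encode (n, k))) /\<^sub>R (real n + 1)"

lemma step_primitive_add: "step_primitive (a + b) n t = step_primitive a n t + step_primitive b n t"
  by (simp add: step_primitive_def sum.distrib scaleR_add_right)

lemma step_primitive_scale: "step_primitive (ell_infty_scale c a) n t = c * step_primitive a n t"
  by (simp add: step_primitive_def flip: sum_distrib_left)

text \<open>
  Between \<open>s\<close> and \<open>t\<close> there are at most \<open>(n+1) (t - s) + 1\<close> steps; the extra one gives the term
  \<open>inverse (n+1)\<close>, which disappears in the limit.
\<close>

lemma norm_step_primitive_diff_le:
  assumes "0 \<le> s" "s \<le> t"
  shows "norm (step_primitive a n t - step_primitive a n s) \<le> norm a * ((t - s) + inverse (real n + 1))"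
proof -
  define u v where "u = nat \<lfloor>(real n + 1) * s\<rfloor>" and "v = nat \<lfloor>(real n + 1) * t\<rfloor>"
  have nn: "0 \<le> \<lfloor>(real n + 1) * s\<rfloor>" "\<lfloor>(real n + 1) * s\<rfloor> \<le> \<lfloor>(real n + 1) * t\<rfloor>"
    using assms by (auto intro!: floor_mono mult_left_mono)
  then have uv: "u \<le> v" by (simp add: u_def v_def nat_mono)
  from nn have "0 \<le> \<lfloor>(real n + 1) * t\<rfloor>" by (rule order_trans)
  with nn have ru: "real u = of_int \<lfloor>(real n + 1) * s\<rfloor>" "real v = of_int \<lfloor>(real n + 1) * t\<rfloor>"
    by (simp_all add: u_def v_def del: zero_le_floor)
  have "real v - real u \<le> (real n + 1) * (t - s) + 1"
    unfolding ru right_diff_distrib by linarith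
  have "{..<v} = {..<u} \<union> {u..<v}" "{..<u} \<inter> {u..<v} = {}" using uv by auto
  then have "step_primitive a n t - step_primitive a n s
      = (\<Sum>k\<in>{u..<v}. apply_bcontfun a (prod_encode (n, k))) /\<^sub>R (real n + 1)"
    unfolding step_primitive_def u_def[symmetric] v_def[symmetric]
    by (simp add: sum.union_disjoint scaleR_add_right)
  moreover have "norm (\<Sum>k\<in>{u..<v}. apply_bcontfun a (prod_encode (n, k))) \<le> (real v - real u) * norm a"
    using sum_norm_bound[of "{u..<v}" "\<lambda>k. apply_bcontfun a (prod_encode (n, k))" "norm a"] uv
    by (simp add: norm_bounded of_nat_diff)
  moreover have "\<dots> \<le> ((real n + 1) * (t - s) + 1) * norm a"
    using \<open>real v - real u \<le> _\<close> by (intro mult_right_mono) auto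
  ultimately have "norm (step_primitive a n t - step_primitive a n s)
      \<le> (((real n + 1) * (t - s) + 1) * norm a) / (real n + 1)"
    by (simp add: divide_inverse mult.commute mult_right_mono)
  also have "\<dots> = norm a * ((t - s) + inverse (real n + 1))"
    by (simp add: field_simps)
  finally show ?thesis .
qed

lemma step_primitive_0: "step_primitive a n 0 = 0"
  by (simp add: step_primitive_def)

lemma step_primitive_averages:
  "step_primitive (averages x) n t = integral {0..real (nat \<lfloor>(real n + 1) * t\<rfloor>) / (real n + 1)} (Linf_fun x)"
proof -
  have "(\<Sum>k<m. integral {real k / (real n + 1)..(real k + 1) / (real n + 1)} (Linf_fun x))
      = integral {0..real m / (real n + 1)} (Linf_fun x)" for m
  proof (induction m)
    case (Suc m)
    have "integral {0..real m / (real n + 1)} (Linf_fun x)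
        + integral {real m / (real n + 1)..(real m + 1) / (real n + 1)} (Linf_fun x)
      = integral {0..(real m + 1) / (real n + 1)} (Linf_fun x)"
      by (rule Henstock_Kurzweil_Integration.integral_combine) (auto simp: Linf_fun_integrable divide_right_mono)
    then show ?case
      by (simp only: sum.lessThan_Suc Suc.IH of_nat_Suc add.commute[of 1 "real m"])
  qed simp
  then show ?thesis
    by (simp add: step_primitive_def apply_averages flip: scaleR_sum_right)
qed

text \<open>
  The left side is the primitive of \<open>x\<close> at the last grid point up to \<open>t\<close>, which is within
  \<open>1/(n+1)\<close> of \<open>t\<close>.
\<close>

lemma step_primitive_averages_tendsto:
  assumes "0 \<le> t"
  shows "(\<lambda>n. step_primitive (averages x) n t) \<longlonglongrightarrow> integral {0..t} (Linf_fun x)"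
proof -
  have "norm (step_primitive (averages x) n t - integral {0..t} (Linf_fun x)) \<le> norm x * inverse (real (Suc n))" for n
  proof -
    define r where "r = real (nat \<lfloor>(real n + 1) * t\<rfloor>) / (real n + 1)"
    have "0 \<le> \<lfloor>(real n + 1) * t\<rfloor>" using assms by simp
    then have m: "real (nat \<lfloor>(real n + 1) * t\<rfloor>) = of_int \<lfloor>(real n + 1) * t\<rfloor>"
      by (simp del: zero_le_floor)
    have le: "of_int \<lfloor>(real n + 1) * t\<rfloor> \<le> (real n + 1) * t" by (rule of_int_floor_le)
    have ge: "(real n + 1) * t - 1 \<le> of_int \<lfloor>(real n + 1) * t\<rfloor>"
      using floor_correct[of "(real n + 1) * t"] by linarith
    have r: "0 \<le> r" "r \<le> t" "t - r \<le> inverse (real (Suc n))"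
    proof -
      show "0 \<le> r" by (simp add: r_def)
      show "r \<le> t" using le unfolding r_def m by (simp add: divide_le_eq mult.commute)
      have "(real n + 1) * t - 1 \<le> (real n + 1) * r" using ge unfolding r_def m by simp
      then have "(real n + 1) * (t - r) \<le> 1" by (simp add: algebra_simps)
      then show "t - r \<le> inverse (real (Suc n))" by (simp add: field_simps)
    qed
    have "integral {0..r} (Linf_fun x) + integral {r..t} (Linf_fun x) = integral {0..t} (Linf_fun x)"
      using r(1,2) Linf_fun_integrable by (rule Henstock_Kurzweil_Integration.integral_combine)
    moreover have "step_primitive (averages x) n t = integral {0..r} (Linf_fun x)"
      unfolding r_def by (rule step_primitive_averages)
    ultimately have "step_primitive (averages x) n t - integral {0..t} (Linf_fun x)
        = integral {0..r} (Linf_fun x) - (integral {0..r} (Linf_fun x) + integral {r..t} (Linf_fun x))" by (simp only:)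
    also have "\<dots> = - integral {r..t} (Linf_fun x)" by simp
    finally have "norm (step_primitive (averages x) n t - integral {0..t} (Linf_fun x)) = norm (integral {r..t} (Linf_fun x))"
      by (simp only: norm_minus_cancel)
    also have "\<dots> \<le> norm x * (t - r)" using r(2) by (rule norm_integral_Linf_fun_le)
    also have "\<dots> \<le> norm x * inverse (real (Suc n))" using r(3) by (intro mult_left_mono) auto
    finally show ?thesis .
  qed
  moreover have "(\<lambda>n. norm x * inverse (real (Suc n))) \<longlonglongrightarrow> norm x * 0"
    by (intro tendsto_intros LIMSEQ_inverse_real_of_nat)
  ultimately have "(\<lambda>n. step_primitive (averages x) n t - integral {0..t} (Linf_fun x)) \<longlonglongrightarrow> 0"
    unfolding mult_zero_right by - (rule Lim_null_comparison, rule always_eventually, rule allI)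
  then show ?thesis by (simp add: LIM_zero_iff)
qed

context
  fixes U :: "nat filter"
  assumes U: "U \<le> sequentially" "U \<noteq> bot"
    and U_lim: "\<And>a :: nat \<Rightarrow> 'k::{real_normed_field, euclidean_space}.
      bounded (range a) \<Longrightarrow> \<exists>l. (a \<longlongrightarrow> l) U"
begin

text \<open>
  Clamping \<open>t\<close> to the unit interval gives a function that is Lipschitz on the whole line.
\<close>

definition limit_primitive :: "'k ell_infty \<Rightarrow> real \<Rightarrow> 'k" where
  "limit_primitive a t = Lim U (\<lambda>n. step_primitive a n (max 0 (min 1 t)))"

lemma limit_primitive_tendsto:
  "((\<lambda>n. step_primitive a n (max 0 (min 1 t))) \<longlongrightarrow> limit_primitive a t) U"
proof -
  define s where "s = max 0 (min 1 t)"
  have s: "0 \<le> s" "s \<le> 1" by (auto simp: s_def)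
  have "norm (step_primitive a n s) \<le> norm a * 2" for n
  proof -
    have "norm (step_primitive a n s) \<le> norm a * (s + inverse (real n + 1))"
      using norm_step_primitive_diff_le[of 0 s a n] s by (simp add: step_primitive_0)
    also have "\<dots> \<le> norm a * 2"
    proof (rule mult_left_mono)
      have "inverse (real n + 1) \<le> 1" by (simp add: field_simps)
      then show "s + inverse (real n + 1) \<le> 2" using s by simp
    qed simp
    finally show ?thesis .
  qed
  then have "bounded (range (\<lambda>n. step_primitive a n s))" by (intro boundedI) auto
  then obtain l where l: "((\<lambda>n. step_primitive a n s) \<longlongrightarrow> l) U" using U_lim by blast
  then have "Lim U (\<lambda>n. step_primitive a n s) = l" using U(2) by (intro tendsto_Lim)
  with l show ?thesis by (simp add: limit_primitive_def s_def)
qed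

lemma limit_primitive_eqI:
  "((\<lambda>n. step_primitive a n (max 0 (min 1 t))) \<longlongrightarrow> l) U \<Longrightarrow> limit_primitive a t = l"
  using tendsto_unique[OF U(2) limit_primitive_tendsto] .

lemma limit_primitive_add: "limit_primitive (a + b) t = limit_primitive a t + limit_primitive b t"
  by (rule limit_primitive_eqI) (simp add: step_primitive_add tendsto_add limit_primitive_tendsto)

lemma limit_primitive_scale: "limit_primitive (ell_infty_scale c a) t = c * limit_primitive a t"
  by (rule limit_primitive_eqI) (simp add: step_primitive_scale tendsto_mult_left limit_primitive_tendsto)

lemma limit_primitive_averages:
  assumes "0 \<le> t" "t \<le> 1"
  shows "limit_primitive (averages x) t = integral {0..t} (Linf_fun x)"
  using assms tendsto_mono[OF U(1) step_primitive_averages_tendsto[of t x]]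
  by (intro limit_primitive_eqI) simp

lemma limit_primitive_lipschitz_le:
  assumes "s \<le> t"
  shows "norm (limit_primitive a t - limit_primitive a s) \<le> norm a * (t - s)"
proof -
  define s' t' where "s' = max 0 (min 1 s)" and "t' = max 0 (min 1 t)"
  have st: "0 \<le> s'" "s' \<le> t'" "t' - s' \<le> t - s" using assms by (auto simp: s'_def t'_def)
  have "((\<lambda>n. norm (step_primitive a n t' - step_primitive a n s')) \<longlongrightarrow> norm (limit_primitive a t - limit_primitive a s)) U"
    unfolding s'_def t'_def by (intro tendsto_intros limit_primitive_tendsto)
  moreover have "((\<lambda>n. norm a * ((t' - s') + inverse (real n + 1))) \<longlongrightarrow> norm a * ((t' - s') + 0)) U"
    using LIMSEQ_inverse_real_of_nat
    by (intro tendsto_mono[OF U(1)] tendsto_intros) (simp add: add.commute)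
  ultimately have "norm (limit_primitive a t - limit_primitive a s) \<le> norm a * ((t' - s') + 0)"
    using U(2) by (elim tendsto_le[rotated]) (auto intro!: always_eventually norm_step_primitive_diff_le st)
  also have "\<dots> \<le> norm a * (t - s)" using st(3) by (intro mult_left_mono) auto
  finally show ?thesis .
qed

lemma limit_primitive_lipschitz: "norm (limit_primitive a s - limit_primitive a t) \<le> norm a * \<bar>s - t\<bar>"
  using limit_primitive_lipschitz_le[of s t a] limit_primitive_lipschitz_le[of t s a]
  by (cases "s \<le> t") (simp_all add: norm_minus_commute)

definition limit_density :: "'k ell_infty \<Rightarrow> real \<Rightarrow> 'k" where
  "limit_density a = (SOME f. f \<in> borel_measurable borel \<and> (\<forall>x. norm (f x) \<le> norm a) \<and>
     (\<forall>s t. s \<le> t \<longrightarrow> (f has_integral (limit_primitive a t - limit_primitive a s)) {s..t}))"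

lemma limit_density:
  "limit_density a \<in> borel_measurable borel" "norm (limit_density a x) \<le> norm a"
  "s \<le> t \<Longrightarrow> (limit_density a has_integral (limit_primitive a t - limit_primitive a s)) {s..t}"
proof -
  have "\<exists>f. f \<in> borel_measurable borel \<and> (\<forall>x. norm (f x) \<le> norm a) \<and>
     (\<forall>s t. s \<le> t \<longrightarrow> (f has_integral (limit_primitive a t - limit_primitive a s)) {s..t})"
    using lipschitz_has_density[of "limit_primitive a" "norm a"] limit_primitive_lipschitz by blast
  from someI_ex[OF this] show "limit_density a \<in> borel_measurable borel" "norm (limit_density a x) \<le> norm a"
    "s \<le> t \<Longrightarrow> (limit_density a has_integral (limit_primitive a t - limit_primitive a s)) {s..t}"
    by (simp_all add: limit_density_def)
qed

text \<open>
  The weak-star limit of the step functions given by \<open>a\<close>, as the derivative of the limit of their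
  primitives.
\<close>

definition weak_limit :: "'k ell_infty \<Rightarrow> 'k Linf" where
  "weak_limit a = Linf_of (limit_density a)"

lemma limit_density_lebesgue: "limit_density a \<in> borel_measurable lebesgue"
  by (rule measurable_completion) (simp add: limit_density(1))

lemma norm_weak_limit_le: "norm (weak_limit a) \<le> norm a"
  unfolding weak_limit_def by (rule norm_Linf_of_le[OF limit_density_lebesgue]) (simp add: limit_density(2))

lemma integral_weak_limit:
  assumes "0 \<le> s" "s \<le> t" "t \<le> 1"
  shows "integral {s..t} (Linf_fun (weak_limit a)) = limit_primitive a t - limit_primitive a s"
proof -
  have "AE u in lebesgue. u \<in> {0..1} \<longrightarrow> Linf_fun (weak_limit a) u = limit_density a u"
    unfolding weak_limit_def
    by (rule AE_Linf_fun_Linf_of[OF limit_density_lebesgue, where C = "norm a"]) (simp add: limit_density(2))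
  then have "integral {s..t} (Linf_fun (weak_limit a)) = integral {s..t} (limit_density a)"
    by (intro integral_AE_cong, eventually_elim) (use assms in auto)
  with limit_density(3)[OF assms(2)] show ?thesis by (simp add: integral_unique)
qed

lemma weak_limit_averages: "weak_limit (averages x) = x"
proof (rule Linf_eqI_integral)
  fix s t :: real assume st: "0 \<le> s" "s \<le> t" "t \<le> 1"
  have "integral {0..s} (Linf_fun x) + integral {s..t} (Linf_fun x) = integral {0..t} (Linf_fun x)"
    using st(1,2) Linf_fun_integrable by (rule Henstock_Kurzweil_Integration.integral_combine)
  then show "integral {s..t} (Linf_fun (weak_limit (averages x))) = integral {s..t} (Linf_fun x)"
    using st by (simp add: integral_weak_limit limit_primitive_averages diff_eq_eq add.commute)
qed

lemma linear_weak_limit: "Vector_Spaces.linear ell_infty_scale Linf_scale weak_limit"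
proof (unfold Vector_Spaces.linear_iff, intro conjI allI)
  show "weak_limit (a + b) = weak_limit a + weak_limit b" for a b
    by (rule Linf_eqI_integral) (simp add: integral_Linf_fun_add integral_weak_limit limit_primitive_add)
  show "weak_limit (ell_infty_scale c a) = Linf_scale c (weak_limit a)" for c a
    by (rule Linf_eqI_integral) (simp add: integral_Linf_fun_scale integral_weak_limit limit_primitive_scale algebra_simps)
qed (fact ell_infty.vector_space_axioms Linf.vector_space_axioms)+

lemma mutually_complemented_Linf_ell_infty:
  "mutually_complemented Linf_scale Linf_coord ell_infty_scale ell_coord block_embedding block_means averages weak_limit"
  by (intro mutually_complemented.intro Linf_power.self_power_axioms ell_power.self_power_axioms
      mutually_complemented_axioms.intro linear_block_embedding linear_block_means linear_averages linear_weak_limit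
      norm_block_embedding_le norm_block_means_le norm_averages_le norm_weak_limit_le block_means_block_embedding weak_limit_averages)

end

lemma Linf_ell_infty_dist:
  "isomorphic (Linf_scale :: 'k \<Rightarrow> 'k Linf \<Rightarrow> 'k Linf)
     (ell_infty_scale :: 'k::{real_normed_field, euclidean_space} \<Rightarrow> 'k ell_infty \<Rightarrow> 'k ell_infty) \<and>
   banach_mazur_dist (Linf_scale :: 'k \<Rightarrow> 'k Linf \<Rightarrow> 'k Linf)
     (ell_infty_scale :: 'k \<Rightarrow> 'k ell_infty \<Rightarrow> 'k ell_infty) \<le> 9 + 6 * sqrt 3"
proof -
  obtain U :: "nat filter" where "U \<le> sequentially" "U \<noteq> bot"
    "\<And>a :: nat \<Rightarrow> 'k. bounded (range a) \<Longrightarrow> \<exists>l. (a \<longlongrightarrow> l) U"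
    using ex_convergent_filter[where 'k = 'k] by blast
  from mutually_complemented_Linf_ell_infty[OF this] show ?thesis
    by (rule mutually_complemented.isomorphic_dist_le)
qed

theorem mainTheorem3:
  shows "isomorphic (Linf_scale :: real \<Rightarrow> real Linf \<Rightarrow> real Linf)
           (ell_infty_scale :: real \<Rightarrow> real ell_infty \<Rightarrow> real ell_infty) \<and>
         banach_mazur_dist (Linf_scale :: real \<Rightarrow> real Linf \<Rightarrow> real Linf)
           (ell_infty_scale :: real \<Rightarrow> real ell_infty \<Rightarrow> real ell_infty) \<le> 9 + 6 * sqrt 3 \<and>
         isomorphic (Linf_scale :: complex \<Rightarrow> complex Linf \<Rightarrow> complex Linf)
           (ell_infty_scale :: complex \<Rightarrow> complex ell_infty \<Rightarrow> complex ell_infty) \<and>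
         banach_mazur_dist (Linf_scale :: complex \<Rightarrow> complex Linf \<Rightarrow> complex Linf)
           (ell_infty_scale :: complex \<Rightarrow> complex ell_infty \<Rightarrow> complex ell_infty) \<le> 9 + 6 * sqrt 3"
  using Linf_ell_infty_dist[where 'k = real] Linf_ell_infty_dist[where 'k = complex] by blast

end
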